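(* Let $p\in(0,1)$. Then the backward shift operator $\mathsf{S_b}$, defined on analytic functions $f(z)=\sum_{n=0}^\infty a_nz^n$ on $\mathbb D$ by $$\mathsf{S_b}(f)(z)=\frac{f(z)-f(0)}{z}=a_1+a_2z+a_3z^2+\cdots,$$ is a bounded linear operator from $\mathcal{CA}_p$ to $\mathcal{CA}_p$ and from $\mathcal{CA}_{0,p}$ to $\mathcal{CA}_{0,p}$.
   Context: $\mathbb D$ is the open unit disk, $\mathbb T$ the unit circle, $|d\xi|=d\theta$ for $\xi=e^{i\theta}$. For an arc $I\subseteq\mathbb T$, $|I|=(2\pi)^{-1}\int_I|d\xi|$ and $f_I=(2\pi|I|)^{-1}\int_I f(\xi)|d\xi|$. $\mathcal{CA}_p$ is the Banach space of all functions $f$ in the Hardy space $\mathcal H^2$ of $\mathbb D$ (identified with their radial boundary values on $\mathbb T$) with $\|f\|_{\mathcal{CA}_p,*}=\sup_{I\subseteq\mathbb T}\left(|I|^{-p}\int_I|f(\xi)-f_I|^2|d\xi|\right)^{1/2}<\infty$ (supremum over all sub-arcs), normed by $\|f\|_{\mathcal{CA}_p}=|f(0)|+\|f\|_{\mathcal{CA}_p,*}$. $\mathcal{CA}_{0,p}$ is the subspace (with the same norm) of those $f\in\mathcal{CA}_p$ with $\lim_{|I|\to0}|I|^{-p}\int_I|f(\xi)-f_I|^2|d\xi|=0$. *)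

theory Defs
  imports "HOL-Complex_Analysis.Complex_Analysis"
begin

text \<open>
  A function on the open unit disk is a total function that is 0 outside the disk, so that
  equality of functions is equality on the disk.
\<close>

definition hardy2 :: "(complex \<Rightarrow> complex) set" where
  "hardy2 = {f. f holomorphic_on ball 0 1 \<and> (\<forall>z. z \<notin> ball 0 1 \<longrightarrow> f z = 0) \<and>
     bdd_above ((\<lambda>r. (LBINT \<theta>:{0..2 * pi}. (cmod (f (of_real r * cis \<theta>)))\<^sup>2) / (2 * pi)) ` {0..<1})}"

definition radial_limit :: "(complex \<Rightarrow> complex) \<Rightarrow> complex \<Rightarrow> complex" where
  "radial_limit f \<xi> = Lim (at_left (1::real)) (\<lambda>r. f (of_real r * \<xi>))"

text \<open>
  The pair \<open>(a, b)\<close> stands for the arc \<open>{cis \<theta> | a \<le> \<theta> \<le> b}\<close>. Whether the endpoints belong to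
  the arc is irrelevant; arcs of length 0 are excluded because the means below divide by the length.
\<close>

definition arcs :: "(real \<times> real) set" where
  "arcs = {(a, b). a < b \<and> b \<le> a + 2 * pi}"

definition arc_length :: "real \<times> real \<Rightarrow> real" where
  "arc_length = (\<lambda>(a, b). (b - a) / (2 * pi))"

definition arc_mean :: "(complex \<Rightarrow> complex) \<Rightarrow> real \<times> real \<Rightarrow> complex" where
  "arc_mean f = (\<lambda>(a, b). (LBINT \<theta>:{a..b}. radial_limit f (cis \<theta>)) /
     of_real (2 * pi * arc_length (a, b)))"

text \<open>
  For \<open>f \<in> hardy2\<close> the radial limits exist almost everywhere and are square integrable (Fatou),
  so the default values of \<open>Lim\<close> and of the Bochner integral play no role here.
\<close>

definition arc_osc :: "real \<Rightarrow> (complex \<Rightarrow> complex) \<Rightarrow> real \<times> real \<Rightarrow> real" where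
  "arc_osc p f = (\<lambda>(a, b). arc_length (a, b) powr (- p) *
     (LBINT \<theta>:{a..b}. (cmod (radial_limit f (cis \<theta>) - arc_mean f (a, b)))\<^sup>2))"

definition campanato :: "real \<Rightarrow> (complex \<Rightarrow> complex) set" where
  "campanato p = {f \<in> hardy2. bdd_above ((\<lambda>I. sqrt (arc_osc p f I)) ` arcs)}"

definition campanato_norm :: "real \<Rightarrow> (complex \<Rightarrow> complex) \<Rightarrow> real" where
  "campanato_norm p f = cmod (f 0) + (SUP I\<in>arcs. sqrt (arc_osc p f I))"

definition campanato0 :: "real \<Rightarrow> (complex \<Rightarrow> complex) set" where
  "campanato0 p = {f \<in> campanato p.
     \<forall>\<epsilon>>0. \<exists>\<delta>>0. \<forall>I\<in>arcs. arc_length I < \<delta> \<longrightarrow> \<bar>arc_osc p f I\<bar> < \<epsilon>}"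

text \<open>
  At the removable singularity 0 the quotient takes the value \<open>a\<^sub>1 = f'(0)\<close>; the lemma
  \<open>backward_shift_sums\<close> confirms the action on Taylor coefficients.
\<close>

definition backward_shift :: "(complex \<Rightarrow> complex) \<Rightarrow> complex \<Rightarrow> complex" where
  "backward_shift f z =
     (if z \<notin> ball 0 1 then 0 else if z = 0 then deriv f 0 else (f z - f 0) / z)"

lemma backward_shift_sums:
  assumes f: "f holomorphic_on ball 0 1" and z: "z \<in> ball 0 1"
  shows "(\<lambda>n. (deriv ^^ Suc n) f 0 / fact (Suc n) * z ^ n) sums backward_shift f z"
proof (cases "z = 0")
  case True
  then show ?thesis
    using powser_sums_zero[of "\<lambda>n. (deriv ^^ Suc n) f 0 / fact (Suc n)"]
    by (simp add: backward_shift_def)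
next
  case False
  have "(\<lambda>n. (deriv ^^ n) f 0 / fact n * (z - 0) ^ n) sums f z"
    by (rule holomorphic_power_series[OF f z])
  then have "(\<lambda>n. (deriv ^^ Suc n) f 0 / fact (Suc n) * z ^ Suc n) sums (f z - f 0)"
    by (subst sums_Suc_iff) simp
  from sums_divide[OF this, of z] show ?thesis
    using False z by (simp add: backward_shift_def)
qed

definition bounded_linear_operator ::
    "((complex \<Rightarrow> complex) \<Rightarrow> real) \<Rightarrow> (complex \<Rightarrow> complex) set \<Rightarrow> (complex \<Rightarrow> complex) set \<Rightarrow>
     ((complex \<Rightarrow> complex) \<Rightarrow> (complex \<Rightarrow> complex)) \<Rightarrow> bool" where
  "bounded_linear_operator N V W T \<longleftrightarrow>
     (\<forall>f\<in>V. T f \<in> W) \<and>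
     (\<forall>f\<in>V. \<forall>g\<in>V. T (\<lambda>z. f z + g z) = (\<lambda>z. T f z + T g z)) \<and>
     (\<forall>c. \<forall>f\<in>V. T (\<lambda>z. c * f z) = (\<lambda>z. c * T f z)) \<and>
     (\<exists>C. \<forall>f\<in>V. N (T f) \<le> C * N f)"

end

theory Submission
  imports Defs
begin

text \<open>
  On an arc \<open>I\<close> starting at \<open>\<alpha>\<close>, the boundary function of \<open>S\<^sub>b f\<close> is \<open>cnj \<xi> * (f \<xi> - f 0)\<close>.
  Replacing \<open>cnj \<xi>\<close> by \<open>cnj \<alpha>\<close> in front of the mean of \<open>f - f 0\<close> costs a constant times \<open>|I|\<^sup>2\<close> times the
  squared norm of \<open>f - f 0\<close> in \<open>L\<^sup>2(I)\<close>, and the squared norm over the whole circle is the oscillation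
  of \<open>f\<close> over the whole circle, because \<open>f 0\<close> is the mean of \<open>f\<close>. As \<open>|I|\<^sup>2\<^sup>-\<^sup>p\<close> tends to 0, both claims
  follow.

  This needs Fatou's theorem for the Hardy space: radial limits exist almost everywhere and have the
  Taylor coefficients of \<open>f\<close> as Fourier coefficients. It is derived from an \<open>L\<^sup>2\<close> bound for the radial
  maximal function, which is proved by duality, without covering lemmas. For a measurable choice of
  radii \<open>r\<close>, the adjoint of \<open>b \<mapsto> \<Sum>n. b n * (r x * cis x) ^ n\<close> sends \<open>l\<close> to coefficients \<open>c\<close> whose
  squared norm is the double integral of \<open>l x * l y\<close> against the real part of the Cauchy kernel at
  radius \<open>r x * r y\<close>. That kernel is at most 8 times the kernel at radius \<open>min (r x) (r y)\<close>, and
  the resulting integrals are inner products of \<open>c\<close> with the Fourier coefficients of \<open>l\<close>. Hence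
  \<open>\<parallel>c\<parallel>\<^sup>2 \<le> const * \<parallel>c\<parallel> * \<parallel>l\<parallel>\<close>.
\<close>

subsection \<open>Integrals over a period and Bessel's inequality\<close>

text \<open>The base point is free so that a period can start at the left end of a given arc: then
  \<open>{a..b}\<close> is a subset of the period and no periodicity argument is required.\<close>

definition period :: "real \<Rightarrow> real measure" where
  "period a = restrict_space lborel {a..a + 2 * pi}"

lemma space_period [simp]: "space (period a) = {a..a + 2 * pi}"
  by (simp add: period_def space_restrict_space)

lemma finite_measure_period: "finite_measure (period a)"
  unfolding period_def by standard (simp add: emeasure_restrict_space space_restrict_space)

lemma measurable_period [measurable (raw)]: "f \<in> borel_measurable borel \<Longrightarrow> f \<in> borel_measurable (period a)"
  unfolding period_def by (simp add: measurable_restrict_space1)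

lemma borel_measurable_cnj [measurable (raw)]:
  "f \<in> borel_measurable M \<Longrightarrow> (\<lambda>x. cnj (f x)) \<in> borel_measurable M"
  by (rule borel_measurable_continuous_on[OF continuous_on_cnj[OF continuous_on_id]])

lemma borel_measurable_cis [measurable]: "cis \<in> borel_measurable borel"
  by (intro borel_measurable_continuous_onI continuous_intros)

lemma pair_sigma_finite_period: "pair_sigma_finite (period a) (period a)"
  using finite_measure_period finite_measure.axioms(1) by (auto simp: pair_sigma_finite_def)

lemma measure_period [simp]: "measure (period a) {a..a + 2 * pi} = 2 * pi"
  unfolding period_def by (subst measure_restrict_space) auto

lemma set_lebesgue_integral_period:
  fixes f :: "real \<Rightarrow> 'b::{banach, second_countable_topology}"
  shows "(LBINT x:{a..a + 2 * pi}. f x) = integral\<^sup>L (period a) f"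
  unfolding set_lebesgue_integral_def period_def by (subst integral_restrict_space) auto

section \<open>Real part of the Cauchy kernel\<close>

text \<open>The quotient on the right is the Poisson kernel at \<open>z\<close>; this form makes
  positivity visible and reduces kernel comparisons to numerators and denominators.\<close>

lemma Re_cauchy_kernel:
  assumes "norm z < 1"
  shows "2 * Re (1 / (1 - z)) = 1 + (1 - (norm z)\<^sup>2) / (norm (1 - z))\<^sup>2"
proof -
  have "z \<noteq> 1" using assms by auto
  then have "norm (1 - z) \<noteq> 0" by simp
  then have "(norm (1 - z))\<^sup>2 \<noteq> 0" by simp
  moreover have "Re (1 / (1 - z)) = (1 - Re z) / (norm (1 - z))\<^sup>2"
    by (simp add: Re_divide cmod_power2)
  moreover have "2 * (1 - Re z) = (norm (1 - z))\<^sup>2 + (1 - (norm z)\<^sup>2)"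
    unfolding cmod_power2 by (simp add: power2_eq_square algebra_simps)
  ultimately show ?thesis by (simp add: field_simps)
qed

lemma Re_cauchy_kernel_pos:
  assumes "norm z < 1"
  shows "0 < Re (1 / (1 - z))"
proof -
  have "(norm z)\<^sup>2 < 1" using assms by (simp add: abs_square_less_1)
  then show ?thesis using Re_cauchy_kernel[OF assms]
    by (smt (verit) zero_le_divide_iff zero_le_power2)
qed

text \<open>Since |w - t w| = (1 - t)|w| \<le> 1 - t|w| \<le> |1 - t w|, the triangle inequality
  gives |1 - w| \<le> 2|1 - t w|. The squared denominators thus cost a factor 4 and the numerators a
  factor 2. It will allow one of two radii to be moved out to the unit circle.\<close>

lemma Re_cauchy_kernel_le:
  assumes w: "norm w \<le> t" "t < 1"
  shows "Re (1 / (1 - of_real t * w)) \<le> 8 * Re (1 / (1 - w))"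
proof -
  let ?\<rho> = "norm w"
  have \<rho>: "0 \<le> ?\<rho>" "?\<rho> < 1" using w by auto
  have t0: "0 \<le> t" using w \<rho> by linarith
  have tw: "norm (of_real t * w) = t * ?\<rho>" using t0 by (simp add: norm_mult)
  have t\<rho>: "t * ?\<rho> < 1" "(1 - t) * ?\<rho> \<le> 1 - t * ?\<rho>"
    using mult_strict_mono'[of t 1 ?\<rho> 1] w \<rho> t0 by (auto simp: algebra_simps)
  have m: "1 - t * ?\<rho> \<le> norm (1 - of_real t * w)"
    using norm_triangle_ineq2[of 1 "of_real t * w"] tw by simp
  have "norm (1 - w) \<le> norm (1 - of_real t * w) + norm (of_real (t - 1) * w)"
    using norm_triangle_ineq[of "1 - of_real t * w" "of_real (t - 1) * w"] by (simp add: algebra_simps)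
  also have "norm (of_real (t - 1) * w) = (1 - t) * ?\<rho>"
    using w norm_of_real[of "t - 1", where 'a = complex] by (simp only: norm_mult) simp
  finally have n: "norm (1 - w) \<le> 2 * norm (1 - of_real t * w)" using m t\<rho> by linarith
  have n0: "0 < norm (1 - w)" using \<rho> by auto
  \<comment> \<open>As |w| \<le> t, the numerator is at most 1 - |w|^4 = (1 - |w|^2)(1 + |w|^2),
    hence at most 2(1 - |w|^2).\<close>
  have "?\<rho> * ?\<rho> \<le> t * ?\<rho>" using w \<rho> by (simp add: mult_right_mono)
  then have "(?\<rho> * ?\<rho>)\<^sup>2 \<le> (t * ?\<rho>)\<^sup>2" by (intro power_mono) auto
  moreover have "0 \<le> (1 - ?\<rho>\<^sup>2)\<^sup>2" by simp
  ultimately have num: "1 - (t * ?\<rho>)\<^sup>2 \<le> 2 * (1 - ?\<rho>\<^sup>2)"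
    by (simp add: power2_eq_square algebra_simps)
  have p: "0 \<le> 1 - ?\<rho>\<^sup>2" using \<rho> by (simp add: abs_square_le_1)
  have "(1 - (t * ?\<rho>)\<^sup>2) / (norm (1 - of_real t * w))\<^sup>2
      \<le> 2 * (1 - ?\<rho>\<^sup>2) / (norm (1 - w) / 2)\<^sup>2"
    using n n0 num p by (intro frac_le power_mono) auto
  also have "\<dots> = 8 * ((1 - ?\<rho>\<^sup>2) / (norm (1 - w))\<^sup>2)" by (simp add: power_divide)
  finally have "(1 - (t * ?\<rho>)\<^sup>2) / (norm (1 - of_real t * w))\<^sup>2
    \<le> 8 * ((1 - ?\<rho>\<^sup>2) / (norm (1 - w))\<^sup>2)" .
  then have "2 * Re (1 / (1 - of_real t * w)) \<le> 8 * (2 * Re (1 / (1 - w)))"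
    using Re_cauchy_kernel[of w] Re_cauchy_kernel[of "of_real t * w"] \<rho>(2) t\<rho>(1) unfolding tw by linarith
  then show ?thesis by linarith
qed

section \<open>Orthogonality of the characters and Bessel's inequality\<close>

lemma integral_cis_period:
  fixes n :: int
  shows "(\<integral>x. cis (of_int n * x) \<partial>period a) = (if n = 0 then of_real (2 * pi) else 0)"
proof (cases "n = 0")
  case True
  then show ?thesis by (simp add: scaleR_conv_of_real)
next
  case False
  let ?F = "\<lambda>x. cis (of_int n * x) / (\<i> * of_int n)"
  have "(\<integral>x. cis (of_int n * x) \<partial>period a) = (\<integral>x. indicator {a..a + 2 * pi} x *\<^sub>R cis (of_int n * x) \<partial>lborel)"
    unfolding period_def by (rule integral_restrict_space) auto
  also have "\<dots> = ?F (a + 2 * pi) - ?F a"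
  proof (rule integral_FTC_Icc)
    show "(?F has_vector_derivative cis (of_int n * x)) (at x within {a..a + 2 * pi})" for x
    proof -
      have "((\<lambda>z. exp (\<i> * (of_int n * z)) / (\<i> * of_int n)) has_field_derivative exp (\<i> * (of_int n * of_real x)))
          (at (of_real x))"
        using False by (auto intro!: derivative_eq_intros simp: field_simps)
      from has_vector_derivative_real_field[OF this] show ?thesis by (simp add: cis_conv_exp)
    qed
  qed (auto intro!: continuous_intros)
  also have "cis (of_int n * (a + 2 * pi)) = cis (of_int n * a) * cis (2 * pi * of_int n)"
    by (simp add: cis_mult algebra_simps)
  also have "cis (2 * pi * of_int n) = 1" by (rule cis_multiple_2pi) simp
  finally show ?thesis using False by simp
qed

lemma integral_cis_orthogonal:
  "(\<integral>x. cnj (cis x ^ n) * cis x ^ m \<partial>period a) = (if n = m then of_real (2 * pi) else 0)"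
proof -
  have "(\<integral>x. cnj (cis x ^ n) * cis x ^ m \<partial>period a) = (\<integral>x. cis (of_int (int m - int n) * x) \<partial>period a)"
    by (rule Bochner_Integration.integral_cong) (auto simp: Complex.DeMoivre cis_cnj cis_mult algebra_simps)
  then show ?thesis by (simp only: integral_cis_period) auto
qed

text \<open>\<open>s\<close> is the orthogonal projection of \<open>l\<close> onto the span of
  \<open>cnj (cis x ^ n)\<close> for \<open>n < N\<close>. In the expansion of the squared norm of
  \<open>l - s\<close> the inner product of \<open>l\<close> with \<open>s\<close> and the squared
  norm of \<open>s\<close> are both \<open>S / (2 * pi)\<close>. The characters have squared norm 2
  pi, whence the factor.\<close>

lemma bessel_period:
  fixes l :: "real \<Rightarrow> complex"
  assumes [measurable]: "l \<in> borel_measurable (period a)" and B: "\<And>x. x \<in> {a..a + 2 * pi} \<Longrightarrow> norm (l x) \<le> B"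
  shows "(\<Sum>n<N. (norm (\<integral>x. l x * cis x ^ n \<partial>period a))\<^sup>2) \<le> 2 * pi * (\<integral>x. (norm (l x))\<^sup>2 \<partial>period a)"
proof -
  interpret finite_measure "period a" by (rule finite_measure_period)
  define c where "c n = (\<integral>x. l x * cis x ^ n \<partial>period a)" for n
  define s where "s x = (\<Sum>n<N. c n * cnj (cis x ^ n) / of_real (2 * pi))" for x
  define S where "S = (\<Sum>n<N. (norm (c n))\<^sup>2)"
  have [measurable]: "s \<in> borel_measurable (period a)"
    unfolding s_def by (intro measurable_period borel_measurable_sum borel_measurable_continuous_onI continuous_intros) simp
  have [measurable]: "(\<lambda>x. cis x ^ n) \<in> borel_measurable (period a)" for n
    by (auto intro!: measurable_period borel_measurable_continuous_onI continuous_intros)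
  have il: "integrable (period a) (\<lambda>x. l x * cis x ^ n)" for n
    by (rule integrable_const_bound[of _ B]) (use B in \<open>auto simp: norm_mult norm_power\<close>)
  have sb: "norm (s x) \<le> (\<Sum>n<N. norm (c n))" for x
    unfolding s_def by (rule sum_norm_le) (use pi_gt3 in \<open>auto simp: norm_mult norm_divide norm_power divide_le_eq intro!: mult_le_cancel_left1[THEN iffD2]\<close>)
  have B0: "0 \<le> B" using order_trans[OF norm_ge_zero B[of a]] by simp
  have S0: "0 \<le> (\<Sum>n<N. norm (c n))" by (simp add: sum_nonneg)
  have i1: "integrable (period a) (\<lambda>x. (norm (l x))\<^sup>2)"
    by (rule integrable_const_bound[of _ "B\<^sup>2"]) (use B in \<open>auto intro!: power_mono\<close>)
  have i2: "integrable (period a) (\<lambda>x. l x * cnj (s x))"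
    by (rule integrable_const_bound[of _ "B * (\<Sum>n<N. norm (c n))"]) (use B sb B0 S0 in \<open>auto simp: norm_mult intro!: mult_mono\<close>)
  have i3: "integrable (period a) (\<lambda>x. s x * cnj (s x))"
    by (rule integrable_const_bound[of _ "(\<Sum>n<N. norm (c n)) * (\<Sum>n<N. norm (c n))"]) (use sb S0 in \<open>auto simp: norm_mult intro!: mult_mono\<close>)
  have "(\<integral>x. l x * cnj (s x) \<partial>period a) = (\<integral>x. (\<Sum>n<N. cnj (c n) / of_real (2 * pi) * (l x * cis x ^ n)) \<partial>period a)"
    by (rule Bochner_Integration.integral_cong) (auto simp: s_def sum_distrib_left field_simps)
  also have "\<dots> = (\<Sum>n<N. cnj (c n) / of_real (2 * pi) * c n)"
    using il by (subst Bochner_Integration.integral_sum) (auto simp: c_def)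
  also have "\<dots> = of_real (S / (2 * pi))"
    unfolding S_def sum_divide_distrib of_real_sum of_real_divide complex_norm_square
    by (intro sum.cong) (simp_all add: mult.commute)
  finally have e2: "(\<integral>x. l x * cnj (s x) \<partial>period a) = of_real (S / (2 * pi))" .
  have i4: "integrable (period a) (\<lambda>x. cnj (cis x ^ n) * cis x ^ m)" for n m
    by (rule integrable_const_bound[of _ 1]) (auto simp: norm_mult norm_power)
  have "(\<integral>x. s x * cnj (s x) \<partial>period a) = (\<integral>x. (\<Sum>n<N. \<Sum>m<N. c n * cnj (c m) / of_real ((2 * pi)\<^sup>2) * (cnj (cis x ^ n) * cis x ^ m)) \<partial>period a)"
    by (rule Bochner_Integration.integral_cong) (auto simp: s_def sum_product power2_eq_square field_simps)
  also have "\<dots> = (\<Sum>n<N. \<Sum>m<N. c n * cnj (c m) / of_real ((2 * pi)\<^sup>2) * (if n = m then of_real (2 * pi) else 0))"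
    using i4 by (subst Bochner_Integration.integral_sum, simp, subst Bochner_Integration.integral_sum) (auto simp: integral_cis_orthogonal[unfolded complex_cnj_power])
  also have "\<dots> = (\<Sum>n<N. c n * cnj (c n) / of_real (2 * pi))"
    by (auto simp: if_distrib sum.delta' power2_eq_square cong: if_cong intro!: sum.cong)
  also have "\<dots> = of_real (S / (2 * pi))"
    unfolding complex_norm_square[symmetric] S_def sum_divide_distrib of_real_sum of_real_divide ..
  finally have e3: "(\<integral>x. s x * cnj (s x) \<partial>period a) = of_real (S / (2 * pi))" .
  have "0 \<le> (\<integral>x. (norm (l x - s x))\<^sup>2 \<partial>period a)" by simp
  also have "(\<lambda>x. (norm (l x - s x))\<^sup>2) = (\<lambda>x. (norm (l x))\<^sup>2 - 2 * Re (l x * cnj (s x)) + Re (s x * cnj (s x)))"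
    unfolding cmod_power2 by (auto simp: fun_eq_iff power2_eq_square algebra_simps)
  also have "(\<integral>x. (norm (l x))\<^sup>2 - 2 * Re (l x * cnj (s x)) + Re (s x * cnj (s x)) \<partial>period a)
     = (\<integral>x. (norm (l x))\<^sup>2 \<partial>period a) - 2 * Re (\<integral>x. l x * cnj (s x) \<partial>period a) + Re (\<integral>x. s x * cnj (s x) \<partial>period a)"
    unfolding integral_Re[OF i2, symmetric] integral_Re[OF i3, symmetric]
    using i1 integrable_Re[OF i2] integrable_Re[OF i3]
    by (simp only: Bochner_Integration.integral_add Bochner_Integration.integral_diff
        Bochner_Integration.integrable_diff integrable_mult_right integral_mult_right_zero)
  finally have "S / (2 * pi) \<le> (\<integral>x. (norm (l x))\<^sup>2 \<partial>period a)" unfolding e2 e3 by simp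
  then show ?thesis by (simp add: S_def c_def field_simps)
qed

section \<open>Double integrals against the Cauchy kernel\<close>

text \<open>The kernel is a geometric series whose terms separate by Fubini, so the double integral
  is the real inner product of two coefficient sequences. The bound \<open>R < 1\<close> on
  \<open>e\<close> alone dominates the series by \<open>B\<^sup>2 * R ^ n\<close>. Hence
  \<open>d\<close> may lie on the unit circle, and \<open>d = cis\<close> yields Fourier
  coefficients.\<close>

lemma double_kernel_sums:
  fixes k l :: "real \<Rightarrow> real" and e d :: "real \<Rightarrow> complex"
  assumes [measurable]: "k \<in> borel_measurable (period a)" "l \<in> borel_measurable (period a)"
      "e \<in> borel_measurable (period a)" "d \<in> borel_measurable (period a)"
    and B: "\<And>x. x \<in> {a..a + 2 * pi} \<Longrightarrow> \<bar>k x\<bar> \<le> B" "\<And>x. x \<in> {a..a + 2 * pi} \<Longrightarrow> \<bar>l x\<bar> \<le> B"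
    and R: "R < 1" "\<And>x. x \<in> {a..a + 2 * pi} \<Longrightarrow> norm (e x) \<le> R" "\<And>x. x \<in> {a..a + 2 * pi} \<Longrightarrow> norm (d x) \<le> 1"
  shows "(\<lambda>n. Re ((\<integral>x. k x * e x ^ n \<partial>period a) * cnj (\<integral>x. l x * d x ^ n \<partial>period a)))
      sums (\<integral>(x, y). k x * l y * Re (1 / (1 - e x * cnj (d y))) \<partial>(period a \<Otimes>\<^sub>M period a))"
    and "integrable (period a \<Otimes>\<^sub>M period a) (\<lambda>(x, y). k x * l y * Re (1 / (1 - e x * cnj (d y))))"
proof -
  interpret finite_measure "period a" by (rule finite_measure_period)
  interpret P: pair_sigma_finite "period a" "period a" by (rule pair_sigma_finite_period)
  have fin2: "finite_measure (period a \<Otimes>\<^sub>M period a)"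
    by (intro finite_measure_pair_measure finite_measure_period)
  interpret F2: finite_measure "period a \<Otimes>\<^sub>M period a" by (rule fin2)
  let ?M = "period a \<Otimes>\<^sub>M period a"
  have B0: "0 \<le> B" using B(1)[of a] by auto
  have R0: "0 \<le> R" using order_trans[OF norm_ge_zero R(2)[of a]] by simp
  define F where "F n xy = (k (fst xy) * e (fst xy) ^ n) * cnj (l (snd xy) * d (snd xy) ^ n)" for n xy
  have [measurable]: "F n \<in> borel_measurable ?M" for n unfolding F_def by measurable
  have Fb: "norm (F n xy) \<le> B\<^sup>2 * R ^ n" if "xy \<in> space ?M" for n xy
  proof -
    have xy: "fst xy \<in> {a..a + 2 * pi}" "snd xy \<in> {a..a + 2 * pi}" using that by (auto simp: space_pair_measure)
    have "norm (F n xy) = (\<bar>k (fst xy)\<bar> * norm (e (fst xy)) ^ n) * (\<bar>l (snd xy)\<bar> * norm (d (snd xy)) ^ n)"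
      by (simp add: F_def norm_mult norm_power)
    also have "\<dots> \<le> (B * R ^ n) * (B * 1 ^ n)"
      using xy B0 R0 by (intro mult_mono power_mono B R) auto
    finally show ?thesis by (simp add: power2_eq_square mult_ac)
  qed
  have iF: "integrable ?M (F n)" for n
    by (rule F2.integrable_const_bound[of _ "B\<^sup>2 * R ^ n"]) (use Fb in auto)
  have sR: "summable (\<lambda>n. B\<^sup>2 * R ^ n)" using R R0 by (intro summable_mult summable_geometric) auto
  have sF: "AE xy in ?M. summable (\<lambda>n. norm (F n xy))"
    by (rule AE_I2) (rule summable_comparison_test'[OF sR, of 0], use Fb in auto)
  have sI: "summable (\<lambda>n. \<integral>xy. norm (F n xy) \<partial>?M)"
  proof (rule summable_comparison_test')
    show "summable (\<lambda>n. B\<^sup>2 * R ^ n * measure ?M (space ?M))"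
      by (rule summable_mult2[OF sR])
    show "norm (\<integral>xy. norm (F n xy) \<partial>?M) \<le> B\<^sup>2 * R ^ n * measure ?M (space ?M)" if "0 \<le> n" for n
    proof -
      have "(\<integral>xy. norm (F n xy) \<partial>?M) \<le> (\<integral>xy. B\<^sup>2 * R ^ n \<partial>?M)"
        by (rule integral_mono) (use iF Fb in auto)
      then show ?thesis by (simp add: mult_ac)
    qed
  qed
  have F_int: "integral\<^sup>L ?M (F n) = (\<integral>x. k x * e x ^ n \<partial>period a) * cnj (\<integral>x. l x * d x ^ n \<partial>period a)" for n
  proof -
    have "integral\<^sup>L ?M (F n) = (\<integral>x. (\<integral>y. F n (x, y) \<partial>period a) \<partial>period a)"
      using P.integral_fst'[OF iF] by simp
    also have "\<dots> = (\<integral>x. (k x * e x ^ n) * (\<integral>y. cnj (l y * d y ^ n) \<partial>period a) \<partial>period a)"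
      by (simp add: F_def)
    also have "\<dots> = (\<integral>x. k x * e x ^ n \<partial>period a) * (\<integral>y. cnj (l y * d y ^ n) \<partial>period a)"
      by simp
    also have "(\<integral>y. cnj (l y * d y ^ n) \<partial>period a) = cnj (\<integral>y. l y * d y ^ n \<partial>period a)"
      by (rule Bochner_Integration.integral_cnj)
    finally show ?thesis .
  qed
  define G where "G xy = (\<Sum>n. F n xy)" for xy
  have G: "G (x, y) = k x * l y * (1 / (1 - e x * cnj (d y)))" if "(x, y) \<in> space ?M" for x y
  proof -
    have xy: "x \<in> {a..a + 2 * pi}" "y \<in> {a..a + 2 * pi}" using that by (auto simp: space_pair_measure)
    have "norm (e x) * norm (d y) \<le> R * 1" using R R0 xy by (intro mult_mono) auto
    then have "norm (e x * cnj (d y)) < 1" using R by (simp add: norm_mult)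
    then have "(\<lambda>n. (k x * l y) * (e x * cnj (d y)) ^ n) sums ((k x * l y) * (1 / (1 - e x * cnj (d y))))"
      by (intro sums_mult geometric_sums)
    then show ?thesis unfolding G_def F_def by (intro sums_unique[symmetric]) (simp add: power_mult_distrib mult_ac)
  qed
  have iG: "integrable ?M G" unfolding G_def by (rule integrable_suminf[OF iF sF sI])
  have "(\<lambda>n. integral\<^sup>L ?M (F n)) sums integral\<^sup>L ?M G"
    unfolding G_def by (rule sums_integral[OF iF sF sI])
  then have "(\<lambda>n. Re (integral\<^sup>L ?M (F n))) sums Re (integral\<^sup>L ?M G)" by (rule sums_Re)
  moreover have eqG: "Re (G xy) = (case xy of (x, y) \<Rightarrow> k x * l y * Re (1 / (1 - e x * cnj (d y))))"
    if "xy \<in> space ?M" for xy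
  proof (cases xy)
    case (Pair x y)
    then have "G xy = of_real (k x * l y) * (1 / (1 - e x * cnj (d y)))" using G[of x y] that by simp
    moreover have "Re (of_real c * z) = c * Re z" for c z by simp
    ultimately show ?thesis by (simp only: Pair prod.case)
  qed
  moreover have "Re (integral\<^sup>L ?M G) = (\<integral>xy. Re (G xy) \<partial>?M)" by (rule integral_Re[OF iG, symmetric])
  moreover have "(\<integral>xy. Re (G xy) \<partial>?M) = (\<integral>(x, y). k x * l y * Re (1 / (1 - e x * cnj (d y))) \<partial>?M)"
    using eqG by (intro Bochner_Integration.integral_cong) auto
  ultimately show "(\<lambda>n. Re ((\<integral>x. k x * e x ^ n \<partial>period a) * cnj (\<integral>x. l x * d x ^ n \<partial>period a)))
      sums (\<integral>(x, y). k x * l y * Re (1 / (1 - e x * cnj (d y))) \<partial>(period a \<Otimes>\<^sub>M period a))"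
    unfolding F_int by simp
  have "integrable ?M (\<lambda>xy. Re (G xy))" using iG by (rule integrable_Re)
  then show "integrable ?M (\<lambda>(x, y). k x * l y * Re (1 / (1 - e x * cnj (d y))))"
    using Bochner_Integration.integrable_cong[of ?M ?M, OF refl eqG] by auto
qed

subsection \<open>The dual maximal inequality\<close>

text \<open>The double integral \<open>Q\<close> equals the sum of the squares of
  \<open>norm (c n)\<close>. Bounding \<open>K\<close> by kernels with one point on the circle turns
  \<open>Q\<close> into an inner product of \<open>c\<close> with the Fourier coefficients
  \<open>d\<close>, which Bessel controls. Nonnegativity of \<open>l\<close> preserves the kernel
  inequality under multiplication by \<open>l x * l y\<close>.\<close>

lemma sum_norm_coeff_nonneg:
  fixes l r :: "real \<Rightarrow> real"
  assumes meas [measurable]: "l \<in> borel_measurable (period a)" "r \<in> borel_measurable (period a)"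
    and l: "\<And>x. x \<in> {a..a + 2 * pi} \<Longrightarrow> 0 \<le> l x" "\<And>x. x \<in> {a..a + 2 * pi} \<Longrightarrow> l x \<le> B"
    and r: "\<And>x. x \<in> {a..a + 2 * pi} \<Longrightarrow> 0 \<le> r x" "\<And>x. x \<in> {a..a + 2 * pi} \<Longrightarrow> r x \<le> R" "R < 1"
  defines "e \<equiv> \<lambda>x. of_real (r x) * cis x"
  defines "K \<equiv> \<lambda>x y. Re (1 / (1 - e x * cnj (e y)))"
  shows "(\<integral>(x, y). l x * l y * K x y \<partial>(period a \<Otimes>\<^sub>M period a)) \<le> 512 * pi * (\<integral>x. (l x)\<^sup>2 \<partial>period a)"
proof -
  let ?M = "period a \<Otimes>\<^sub>M period a"
  interpret P: pair_sigma_finite "period a" "period a" by (rule pair_sigma_finite_period)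
  have [measurable]: "cis \<in> borel_measurable (period a)"
    by (auto intro!: measurable_period borel_measurable_continuous_onI continuous_intros)
  have [measurable]: "e \<in> borel_measurable (period a)" unfolding e_def by measurable
  have lB: "\<bar>l x\<bar> \<le> B" if "x \<in> {a..a + 2 * pi}" for x using l[OF that] by simp
  have ne: "norm (e x) = r x" if "x \<in> {a..a + 2 * pi}" for x using r(1)[OF that] by (simp add: e_def norm_mult)
  have eR: "norm (e x) \<le> R" "norm (e x) \<le> 1" if "x \<in> {a..a + 2 * pi}" for x
    using ne[OF that] r(2)[OF that] r(3) by auto
  define H where "H x y = Re (1 / (1 - e x * cnj (cis y)))" for x y
  define c where "c n = (\<integral>x. of_real (l x) * e x ^ n \<partial>period a)" for n
  define d where "d n = (\<integral>x. of_real (l x) * cis x ^ n \<partial>period a)" for n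
  define Q where "Q = (\<integral>(x, y). l x * l y * K x y \<partial>?M)"
  define T where "T = (\<integral>(x, y). l x * l y * H x y \<partial>?M)"
  define E where "E = 2 * pi * (\<integral>x. (l x)\<^sup>2 \<partial>period a)"
  have sQ: "(\<lambda>n. Re (c n * cnj (c n))) sums Q" and iQ: "integrable ?M (\<lambda>(x, y). l x * l y * K x y)"
    unfolding c_def Q_def K_def
    using double_kernel_sums[OF meas(1) meas(1) \<open>e \<in> borel_measurable (period a)\<close> \<open>e \<in> borel_measurable (period a)\<close> lB lB r(3) eR(1) eR(2)]
    by blast+
  have sT: "(\<lambda>n. Re (c n * cnj (d n))) sums T" and iT: "integrable ?M (\<lambda>(x, y). l x * l y * H x y)"
    unfolding c_def d_def T_def H_def
    using double_kernel_sums[OF meas(1) meas(1) \<open>e \<in> borel_measurable (period a)\<close> \<open>cis \<in> borel_measurable (period a)\<close> lB lB r(3) eR(1)]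
    by simp_all
  have sQ': "(\<lambda>n. (norm (c n))\<^sup>2) sums Q"
    using sQ by (simp only: complex_norm_square[symmetric] Re_complex_of_real)
  have iT': "integrable ?M (\<lambda>(x, y). l x * l y * H y x)"
    using P.integrable_product_swap[OF iT] by (simp add: mult.commute)
  have T': "(\<integral>(x, y). l x * l y * H y x \<partial>?M) = T"
    using P.integral_product_swap[of "\<lambda>(x, y). l x * l y * H x y"] iT by (simp add: T_def mult.commute)
  have K_le: "K x y \<le> 8 * (H x y + H y x)" if xy: "x \<in> {a..a + 2 * pi}" "y \<in> {a..a + 2 * pi}" for x y
  proof -
    have aux: "Re (1 / (1 - e u * cnj (e v))) \<le> 8 * H u v" if "u \<in> {a..a + 2 * pi}" "v \<in> {a..a + 2 * pi}" "r u \<le> r v" for u v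
    proof -
      have "norm (e u * cnj (cis v)) \<le> r v" using that ne[of u] by (simp add: norm_mult)
      moreover have "r v < 1" using r(2)[of v] r(3) that by simp
      moreover have "of_real (r v) * (e u * cnj (cis v)) = e u * cnj (e v)" by (simp add: e_def)
      ultimately show ?thesis unfolding H_def using Re_cauchy_kernel_le by metis
    qed
    have pos: "0 \<le> H u v" if "u \<in> {a..a + 2 * pi}" for u v
      unfolding H_def using eR[OF that] r(3) by (intro less_imp_le Re_cauchy_kernel_pos) (simp add: norm_mult)
    have sym: "K x y = K y x"
    proof -
      have "1 / (1 - e x * cnj (e y)) = cnj (1 / (1 - e y * cnj (e x)))" by (simp add: mult.commute)
      then show ?thesis unfolding K_def by (metis complex_cnj(1) complex.sel(1) cnj.simps(1))
    qed
    show ?thesis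
    proof (cases "r x \<le> r y")
      case True then show ?thesis using aux[of x y] pos[of y x] xy by (auto simp: K_def)
    next
      case False then show ?thesis using aux[of y x] pos[of x y] xy sym by (auto simp: K_def)
    qed
  qed
  have "Q \<le> (\<integral>xy. 8 * (case xy of (x, y) \<Rightarrow> l x * l y * H x y) + 8 * (case xy of (x, y) \<Rightarrow> l x * l y * H y x) \<partial>?M)"
    unfolding Q_def
  proof (rule integral_mono[OF iQ])
    fix xy assume "xy \<in> space ?M"
    then obtain x y where xy: "xy = (x, y)" "x \<in> {a..a + 2 * pi}" "y \<in> {a..a + 2 * pi}"
      by (auto simp: space_pair_measure)
    have "l x * l y * K x y \<le> l x * l y * (8 * (H x y + H y x))"
      using K_le l(1) xy by (intro mult_left_mono) auto
    then show "(case xy of (x, y) \<Rightarrow> l x * l y * K x y)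
        \<le> 8 * (case xy of (x, y) \<Rightarrow> l x * l y * H x y) + 8 * (case xy of (x, y) \<Rightarrow> l x * l y * H y x)"
      by (simp add: xy(1) algebra_simps)
  qed (use iT iT' in auto)
  \<comment> \<open>Exchanging the variables shows that both mixed kernels have the same integral
    \<open>T\<close>.\<close>
  also have "\<dots> = 16 * T"
    using iT iT' by (subst Bochner_Integration.integral_add) (auto simp: T' T_def[symmetric])
  finally have QT: "Q \<le> 16 * T" .
  have Q0: "0 \<le> Q" using sQ' by (auto simp: sums_iff intro: suminf_nonneg)
  have E0: "0 \<le> E" unfolding E_def by simp
  have part_c: "(\<Sum>n<N. (norm (c n))\<^sup>2) \<le> Q" for N
    using sQ' by (auto simp: sums_iff intro: sum_le_suminf)
  have part_d: "(\<Sum>n<N. (norm (d n))\<^sup>2) \<le> E" for N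
    using bessel_period[of "\<lambda>x. of_real (l x)" a B N] lB unfolding d_def E_def by simp
  have "(\<Sum>n<N. Re (c n * cnj (d n))) \<le> sqrt Q * sqrt E" for N
  proof -
    have "(\<Sum>n<N. Re (c n * cnj (d n))) \<le> (\<Sum>n<N. \<bar>norm (c n)\<bar> * \<bar>norm (d n)\<bar>)"
      by (intro sum_mono) (metis abs_norm_cancel complex_Re_le_cmod complex_mod_cnj norm_mult)
    also have "\<dots> \<le> L2_set (\<lambda>n. norm (c n)) {..<N} * L2_set (\<lambda>n. norm (d n)) {..<N}"
      by (rule L2_set_mult_ineq)
    also have "\<dots> \<le> sqrt Q * sqrt E"
      unfolding L2_set_def using part_c part_d by (intro mult_mono) (auto simp: sum_nonneg Q0)
    finally show ?thesis .
  qed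
  then have "T \<le> sqrt Q * sqrt E" using sT unfolding sums_def by (intro LIMSEQ_le_const2) auto
  \<comment> \<open>One factor \<open>sqrt Q\<close> cancels unless \<open>Q = 0\<close>, where the
    claim is trivial. Squaring 16 gives 256, and \<open>E\<close> contributes another 2 pi.\<close>
  then have "sqrt Q * sqrt Q \<le> sqrt Q * (16 * sqrt E)" using QT Q0 by simp
  then have "sqrt Q \<le> 16 * sqrt E"
    using Q0 E0 by (cases "Q = 0") (simp_all only: mult_le_cancel_left real_sqrt_gt_0_iff, auto)
  then have "(sqrt Q)\<^sup>2 \<le> (16 * sqrt E)\<^sup>2" using Q0 by (intro power_mono) auto
  then have "Q \<le> 256 * E" using Q0 E0 by (simp add: power_mult_distrib)
  then show ?thesis unfolding Q_def E_def by simp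
qed

text \<open>The kernel is positive, so passing from \<open>l\<close> to its absolute value can only
  increase the double integral.\<close>

lemma sum_norm_coeff_real:
  fixes l r :: "real \<Rightarrow> real"
  assumes meas [measurable]: "l \<in> borel_measurable (period a)" "r \<in> borel_measurable (period a)"
    and l: "\<And>x. x \<in> {a..a + 2 * pi} \<Longrightarrow> \<bar>l x\<bar> \<le> B"
    and r: "\<And>x. x \<in> {a..a + 2 * pi} \<Longrightarrow> 0 \<le> r x" "\<And>x. x \<in> {a..a + 2 * pi} \<Longrightarrow> r x \<le> R" "R < 1"
  shows "(\<Sum>n<N. (norm (\<integral>x. of_real (l x) * (of_real (r x) * cis x) ^ n \<partial>period a))\<^sup>2)
    \<le> 512 * pi * (\<integral>x. (l x)\<^sup>2 \<partial>period a)"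
proof -
  let ?M = "period a \<Otimes>\<^sub>M period a"
  define e where "e x = of_real (r x) * cis x" for x
  have [measurable]: "cis \<in> borel_measurable (period a)"
    by (auto intro!: measurable_period borel_measurable_continuous_onI continuous_intros)
  have em [measurable]: "e \<in> borel_measurable (period a)" unfolding e_def by measurable
  have lm: "(\<lambda>x. \<bar>l x\<bar>) \<in> borel_measurable (period a)" by measurable
  have eR: "norm (e x) \<le> R" "norm (e x) \<le> 1" if "x \<in> {a..a + 2 * pi}" for x
    using r(1,2)[OF that] r(3) by (auto simp: e_def norm_mult)
  define K where "K x y = Re (1 / (1 - e x * cnj (e y)))" for x y
  define c where "c n = (\<integral>x. of_real (l x) * e x ^ n \<partial>period a)" for n
  define Q where "Q = (\<integral>(x, y). l x * l y * K x y \<partial>?M)"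
  have sQ: "(\<lambda>n. Re (c n * cnj (c n))) sums Q" and iQ: "integrable ?M (\<lambda>(x, y). l x * l y * K x y)"
    unfolding c_def Q_def K_def
    using double_kernel_sums[OF meas(1) meas(1) em em l l r(3) eR(1) eR(2)] by blast+
  have iQ': "integrable ?M (\<lambda>(x, y). \<bar>l x\<bar> * \<bar>l y\<bar> * K x y)"
    unfolding K_def
    using double_kernel_sums(2)[OF lm lm em em _ _ r(3) eR, of B] l by simp
  have "Q \<le> (\<integral>(x, y). \<bar>l x\<bar> * \<bar>l y\<bar> * K x y \<partial>?M)"
    unfolding Q_def
  proof (rule integral_mono[OF iQ iQ'])
    fix xy assume "xy \<in> space ?M"
    then obtain x y where xy: "xy = (x, y)" "x \<in> {a..a + 2 * pi}" "y \<in> {a..a + 2 * pi}"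
      by (auto simp: space_pair_measure)
    have "norm (e x) * norm (e y) \<le> R * 1"
      using eR xy order_trans[OF norm_ge_zero eR(1)] by (intro mult_mono) auto
    then have "0 \<le> K x y"
      unfolding K_def using r(3) by (intro less_imp_le Re_cauchy_kernel_pos) (simp add: norm_mult)
    then have "l x * l y * K x y \<le> \<bar>l x * l y\<bar> * K x y" by (intro mult_right_mono) auto
    then show "(case xy of (x, y) \<Rightarrow> l x * l y * K x y) \<le> (case xy of (x, y) \<Rightarrow> \<bar>l x\<bar> * \<bar>l y\<bar> * K x y)"
      by (simp add: xy(1) abs_mult)
  qed
  also have "\<dots> \<le> 512 * pi * (\<integral>x. \<bar>l x\<bar>\<^sup>2 \<partial>period a)"
    unfolding K_def e_def by (rule sum_norm_coeff_nonneg[OF lm meas(2) _ l r]) auto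
  finally have Q: "Q \<le> 512 * pi * (\<integral>x. (l x)\<^sup>2 \<partial>period a)" by simp
  have "(\<lambda>n. (norm (c n))\<^sup>2) sums Q"
    using sQ by (simp only: complex_norm_square[symmetric] Re_complex_of_real)
  then have "(\<Sum>n<N. (norm (c n))\<^sup>2) \<le> Q"
    by (auto simp: sums_iff intro: sum_le_suminf)
  with Q show ?thesis unfolding c_def e_def by linarith
qed

text \<open>Real and imaginary parts are treated separately; the inequality \<open>two\<close> for
  the square of a sum doubles the constant.\<close>

lemma sum_norm_coeff:
  fixes g :: "real \<Rightarrow> complex" and r :: "real \<Rightarrow> real"
  assumes meas [measurable]: "g \<in> borel_measurable (period a)" "r \<in> borel_measurable (period a)"
    and g: "\<And>x. x \<in> {a..a + 2 * pi} \<Longrightarrow> norm (g x) \<le> B"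
    and r: "\<And>x. x \<in> {a..a + 2 * pi} \<Longrightarrow> 0 \<le> r x" "\<And>x. x \<in> {a..a + 2 * pi} \<Longrightarrow> r x \<le> R" "R < 1"
  shows "(\<Sum>n<N. (norm (\<integral>x. g x * (of_real (r x) * cis x) ^ n \<partial>period a))\<^sup>2)
    \<le> 1024 * pi * (\<integral>x. (norm (g x))\<^sup>2 \<partial>period a)"
proof -
  interpret finite_measure "period a" by (rule finite_measure_period)
  define e where "e x = of_real (r x) * cis x" for x
  have [measurable]: "cis \<in> borel_measurable (period a)"
    by (auto intro!: measurable_period borel_measurable_continuous_onI continuous_intros)
  have em [measurable]: "e \<in> borel_measurable (period a)" unfolding e_def by measurable
  have e1: "norm (e x) \<le> 1" if "x \<in> {a..a + 2 * pi}" for x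
    using r(1,2)[OF that] r(3) by (auto simp: e_def norm_mult)
  define u v where "u = (\<lambda>x. Re (g x))" and "v = (\<lambda>x. Im (g x))"
  have uv [measurable]: "u \<in> borel_measurable (period a)" "v \<in> borel_measurable (period a)"
    unfolding u_def v_def by measurable
  have ub: "\<bar>u x\<bar> \<le> B" "\<bar>v x\<bar> \<le> B" if "x \<in> {a..a + 2 * pi}" for x
    unfolding u_def v_def using g[OF that] abs_Re_le_cmod[of "g x"] abs_Im_le_cmod[of "g x"] by auto
  have ie: "integrable (period a) (\<lambda>x. of_real (w x) * e x ^ n)"
    if [measurable]: "w \<in> borel_measurable (period a)" and "\<And>x. x \<in> {a..a + 2 * pi} \<Longrightarrow> \<bar>w x\<bar> \<le> B" for w n
  proof (rule integrable_const_bound[of _ B])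
    show "AE x in period a. norm (of_real (w x) * e x ^ n) \<le> B"
    proof (rule AE_I2)
      fix x assume x: "x \<in> space (period a)"
      have "\<bar>w x\<bar> * norm (e x) ^ n \<le> B * 1"
        using that(2)[of x] x e1[of x] by (intro mult_mono power_le_one) auto
      then show "norm (of_real (w x) * e x ^ n) \<le> B" by (simp add: norm_mult norm_power)
    qed
  qed measurable
  have sq: "integrable (period a) (\<lambda>x. (w x)\<^sup>2)"
    if [measurable]: "w \<in> borel_measurable (period a)" and "\<And>x. x \<in> {a..a + 2 * pi} \<Longrightarrow> \<bar>w x\<bar> \<le> B" for w
    by (rule integrable_const_bound[of _ "B\<^sup>2"]) (use that(2) in \<open>auto intro!: power_mono[of "\<bar>w _\<bar>" B 2, simplified]\<close>)
  define c d where "c n = (\<integral>x. of_real (u x) * e x ^ n \<partial>period a)"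
    and "d n = (\<integral>x. of_real (v x) * e x ^ n \<partial>period a)" for n
  have split: "(\<integral>x. g x * e x ^ n \<partial>period a) = c n + \<i> * d n" for n
  proof -
    have "(\<integral>x. g x * e x ^ n \<partial>period a) = (\<integral>x. of_real (u x) * e x ^ n + \<i> * (of_real (v x) * e x ^ n) \<partial>period a)"
    proof (rule Bochner_Integration.integral_cong)
      show "g x * e x ^ n = of_real (u x) * e x ^ n + \<i> * (of_real (v x) * e x ^ n)" for x
        using complex_eq[of "g x"] unfolding u_def v_def by (metis distrib_right mult.assoc)
    qed simp
    also have "\<dots> = c n + \<i> * d n"
      unfolding c_def d_def using ie[OF uv(1) ub(1)] ie[OF uv(2) ub(2)] by simp
    finally show ?thesis .
  qed
  have two: "(norm (z + \<i> * w))\<^sup>2 \<le> 2 * (norm z)\<^sup>2 + 2 * (norm w)\<^sup>2" for z w :: complex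
  proof -
    have "(norm (z + \<i> * w))\<^sup>2 \<le> (norm z + norm w)\<^sup>2"
      using norm_triangle_ineq[of z "\<i> * w"] by (intro power_mono) (auto simp: norm_mult)
    also have "\<dots> \<le> 2 * (norm z)\<^sup>2 + 2 * (norm w)\<^sup>2"
      using zero_le_power2[of "norm z - norm w"] by (simp add: power2_eq_square algebra_simps)
    finally show ?thesis .
  qed
  have "(\<Sum>n<N. (norm (\<integral>x. g x * e x ^ n \<partial>period a))\<^sup>2) \<le> (\<Sum>n<N. 2 * (norm (c n))\<^sup>2 + 2 * (norm (d n))\<^sup>2)"
    unfolding split by (intro sum_mono two)
  also have "\<dots> = 2 * (\<Sum>n<N. (norm (c n))\<^sup>2) + 2 * (\<Sum>n<N. (norm (d n))\<^sup>2)"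
    by (simp add: sum.distrib sum_distrib_left)
  also have "\<dots> \<le> 2 * (512 * pi * (\<integral>x. (u x)\<^sup>2 \<partial>period a)) + 2 * (512 * pi * (\<integral>x. (v x)\<^sup>2 \<partial>period a))"
    unfolding c_def d_def e_def
    by (intro add_mono mult_left_mono sum_norm_coeff_real[OF _ meas(2) _ r]) (use ub in auto)
  also have "\<dots> = 1024 * pi * ((\<integral>x. (u x)\<^sup>2 \<partial>period a) + (\<integral>x. (v x)\<^sup>2 \<partial>period a))"
    by (simp add: algebra_simps)
  also have "(\<integral>x. (u x)\<^sup>2 \<partial>period a) + (\<integral>x. (v x)\<^sup>2 \<partial>period a) = (\<integral>x. (norm (g x))\<^sup>2 \<partial>period a)"
    using sq[OF uv(1) ub(1)] sq[OF uv(2) ub(2)]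
    by (subst Bochner_Integration.integral_add[symmetric]) (auto simp: u_def v_def cmod_power2)
  finally show ?thesis unfolding e_def .
qed

subsection \<open>The radial maximal function\<close>

text \<open>Nothing is known about \<open>f\<close> outside the disk, so measurability passes
  through the Borel space restricted to the disk, where \<open>f\<close> is continuous.\<close>

lemma measurable_holomorphic_compose:
  assumes "f holomorphic_on ball 0 1" "e \<in> borel_measurable M" "\<And>x. x \<in> space M \<Longrightarrow> norm (e x) < 1"
  shows "(\<lambda>x. f (e x)) \<in> borel_measurable M"
proof (rule measurable_compose[of e M "restrict_space borel (ball 0 1)" f borel])
  show "e \<in> M \<rightarrow>\<^sub>M restrict_space borel (ball 0 1)"
    using assms(2,3) by (intro measurable_restrict_space2) auto
  show "f \<in> borel_measurable (restrict_space borel (ball 0 1))"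
    using assms(1) by (intro borel_measurable_continuous_on_restrict holomorphic_on_imp_continuous_on)
qed

section \<open>Square means along a measurable choice of radii\<close>

lemma power_series_integral:
  fixes h :: "real \<Rightarrow> complex" and e :: "real \<Rightarrow> complex"
  assumes b: "\<And>z. norm z < 1 \<Longrightarrow> (\<lambda>n. b n * z ^ n) sums f z"
    and [measurable]: "e \<in> borel_measurable (period a)" "h \<in> borel_measurable (period a)"
    and e: "\<And>x. x \<in> {a..a + 2 * pi} \<Longrightarrow> norm (e x) \<le> R" "R < 1"
    and h: "\<And>x. x \<in> {a..a + 2 * pi} \<Longrightarrow> norm (h x) \<le> B"
  shows "(\<lambda>n. b n * (\<integral>x. h x * e x ^ n \<partial>period a)) sums (\<integral>x. f (e x) * h x \<partial>period a)"
proof -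
  interpret finite_measure "period a" by (rule finite_measure_period)
  have R0: "0 \<le> R" using order_trans[OF norm_ge_zero e(1)[of a]] by simp
  \<comment> \<open>Convergence at the larger radius \<open>S\<close> gives absolute convergence at
    \<open>R\<close>, which supplies the summable majorant for termwise integration.\<close>
  obtain S where S: "R < S" "S < 1" using e(2) dense by blast
  have "summable (\<lambda>n. b n * of_real S ^ n)" using b[of "of_real S"] S R0 by (auto simp: sums_iff)
  then have "summable (\<lambda>n. norm (b n * of_real R ^ n))"
    using S R0 by (elim powser_insidea) auto
  then have sR: "summable (\<lambda>n. norm (b n) * R ^ n * B)"
    using R0 by (intro summable_mult2) (simp add: norm_mult norm_power)
  define G where "G n x = b n * (h x * e x ^ n)" for n x
  have [measurable]: "G n \<in> borel_measurable (period a)" for n unfolding G_def by measurable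
  have Gb: "norm (G n x) \<le> norm (b n) * R ^ n * B" if "x \<in> {a..a + 2 * pi}" for n x
  proof -
    have "norm (G n x) = norm (b n) * (norm (e x) ^ n * norm (h x))" by (simp add: G_def norm_mult norm_power)
    also have "\<dots> \<le> norm (b n) * (R ^ n * B)"
      using e(1)[OF that] h[OF that] R0 by (intro mult_left_mono mult_mono power_mono) auto
    finally show ?thesis by (simp add: mult_ac)
  qed
  have iG: "integrable (period a) (G n)" for n
    by (rule integrable_const_bound[of _ "norm (b n) * R ^ n * B"]) (use Gb in auto)
  have sG: "AE x in period a. summable (\<lambda>n. norm (G n x))"
    by (rule AE_I2, rule summable_comparison_test'[OF sR, of 0]) (use Gb in auto)
  have sI: "summable (\<lambda>n. \<integral>x. norm (G n x) \<partial>period a)"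
  proof (rule summable_comparison_test'[OF summable_mult2[OF sR]])
    show "norm (\<integral>x. norm (G n x) \<partial>period a) \<le> norm (b n) * R ^ n * B * measure (period a) (space (period a))" if "0 \<le> n" for n
    proof -
      have "(\<integral>x. norm (G n x) \<partial>period a) \<le> (\<integral>x. norm (b n) * R ^ n * B \<partial>period a)"
        by (rule integral_mono) (use iG Gb in auto)
      then show ?thesis by (simp add: mult_ac)
    qed
  qed
  have "(\<integral>x. (\<Sum>n. G n x) \<partial>period a) = (\<integral>x. f (e x) * h x \<partial>period a)"
  proof (rule Bochner_Integration.integral_cong)
    fix x assume "x \<in> space (period a)"
    then have "norm (e x) < 1" using e by fastforce
    from sums_mult2[OF b[OF this], of "h x"] show "(\<Sum>n. G n x) = f (e x) * h x"
      unfolding G_def by (simp add: sums_iff mult_ac)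
  qed simp
  moreover have "(\<lambda>n. integral\<^sup>L (period a) (G n)) sums (\<integral>x. (\<Sum>n. G n x) \<partial>period a)"
    by (rule sums_integral[OF iG sG sI])
  ultimately show ?thesis unfolding G_def by simp
qed

text \<open>This is the duality step. Pairing \<open>f (e x)\<close> with its own conjugate writes
  the integral \<open>X\<close> as the sum of \<open>b n * c n\<close>, where the squared norm of
  \<open>c\<close> is at most 1024 pi \<open>X\<close>. Cauchy-Schwarz bounds \<open>X\<close> by a
  multiple of its own square root, and one root cancels. \<open>R\<close> ensures that
  \<open>f\<close> is bounded along the radii, but does not enter the constant.\<close>

lemma integral_square_along_radii_le:
  fixes r :: "real \<Rightarrow> real"
  assumes f: "f holomorphic_on ball 0 1"
    and b: "\<And>z. norm z < 1 \<Longrightarrow> (\<lambda>n. b n * z ^ n) sums f z"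
    and A: "summable (\<lambda>n. (norm (b n))\<^sup>2)"
    and [measurable]: "r \<in> borel_measurable (period a)"
    and r: "\<And>x. x \<in> {a..a + 2 * pi} \<Longrightarrow> 0 \<le> r x" "\<And>x. x \<in> {a..a + 2 * pi} \<Longrightarrow> r x \<le> R" "R < 1"
  shows "integrable (period a) (\<lambda>x. (norm (f (of_real (r x) * cis x)))\<^sup>2)"
    and "(\<integral>x. (norm (f (of_real (r x) * cis x)))\<^sup>2 \<partial>period a) \<le> 1024 * pi * (\<Sum>n. (norm (b n))\<^sup>2)"
proof -
  interpret finite_measure "period a" by (rule finite_measure_period)
  define e where "e x = of_real (r x) * cis x" for x
  have [measurable]: "e \<in> borel_measurable (period a)" unfolding e_def by measurable
  have eR: "norm (e x) \<le> R" if "x \<in> {a..a + 2 * pi}" for x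
    using r(1,2)[OF that] by (simp add: e_def norm_mult)
  have [measurable]: "(\<lambda>x. f (e x)) \<in> borel_measurable (period a)"
    by (rule measurable_holomorphic_compose[OF f]) (use eR r(3) in fastforce)+
  have "compact (f ` cball 0 R)"
    using r(3) by (intro compact_continuous_image continuous_on_subset[OF holomorphic_on_imp_continuous_on[OF f]]) auto
  then obtain B where B: "\<And>z. norm z \<le> R \<Longrightarrow> norm (f z) \<le> B"
    using compact_imp_bounded bounded_pos by (metis (no_types, lifting) bounded_iff imageI mem_cball_0)
  have fB: "norm (f (e x)) \<le> B" if "x \<in> {a..a + 2 * pi}" for x using B eR[OF that] by blast
  show int: "integrable (period a) (\<lambda>x. (norm (f (of_real (r x) * cis x)))\<^sup>2)"
    unfolding e_def[symmetric]
    by (rule integrable_const_bound[of _ "B\<^sup>2"]) (use fB in \<open>auto intro!: power_mono\<close>)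
  define X where "X = (\<integral>x. (norm (f (e x)))\<^sup>2 \<partial>period a)"
  define Y where "Y = (\<Sum>n. (norm (b n))\<^sup>2)"
  have X0: "0 \<le> X" unfolding X_def by simp
  have Y0: "0 \<le> Y" unfolding Y_def using A by (intro suminf_nonneg) auto
  define c where "c n = (\<integral>x. cnj (f (e x)) * e x ^ n \<partial>period a)" for n
  have "(\<lambda>n. b n * c n) sums (\<integral>x. f (e x) * cnj (f (e x)) \<partial>period a)"
    unfolding c_def by (rule power_series_integral[OF b _ _ eR r(3), where B = B]) (use fB in auto)
  also have "(\<integral>x. f (e x) * cnj (f (e x)) \<partial>period a) = of_real X"
    unfolding X_def complex_norm_square[symmetric] by (rule integral_of_real[OF int[folded e_def]])
  finally have sX: "(\<lambda>n. b n * c n) sums of_real X" .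
  have pb: "(\<Sum>n<N. (norm (b n))\<^sup>2) \<le> Y" for N unfolding Y_def by (rule sum_le_suminf[OF A]) auto
  have cm: "(\<lambda>x. cnj (f (e x))) \<in> borel_measurable (period a)" by measurable
  have pc: "(\<Sum>n<N. (norm (c n))\<^sup>2) \<le> 1024 * pi * X" for N
    using sum_norm_coeff[OF cm assms(4) _ r, of B N] fB unfolding c_def X_def e_def by simp
  have "norm (\<Sum>n<N. b n * c n) \<le> sqrt Y * sqrt (1024 * pi * X)" for N
  proof -
    have "norm (\<Sum>n<N. b n * c n) \<le> (\<Sum>n<N. \<bar>norm (b n)\<bar> * \<bar>norm (c n)\<bar>)"
      by (rule sum_norm_le) (simp add: norm_mult)
    also have "\<dots> \<le> L2_set (\<lambda>n. norm (b n)) {..<N} * L2_set (\<lambda>n. norm (c n)) {..<N}"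
      by (rule L2_set_mult_ineq)
    also have "\<dots> \<le> sqrt Y * sqrt (1024 * pi * X)"
      unfolding L2_set_def by (intro mult_mono real_sqrt_le_mono pb pc) (auto simp: sum_nonneg Y0)
    finally show ?thesis .
  qed
  then have "norm (of_real X :: complex) \<le> sqrt Y * sqrt (1024 * pi * X)"
    using sX unfolding sums_def by (intro LIMSEQ_le_const2[OF tendsto_norm]) auto
  then have "X \<le> sqrt (Y * (1024 * pi * X))" using X0 by (simp add: real_sqrt_mult)
  then have "X\<^sup>2 \<le> (sqrt (Y * (1024 * pi * X)))\<^sup>2" using X0 by (intro power_mono) auto
  then have "X * X \<le> X * (1024 * pi * Y)" using X0 Y0 by (simp add: power2_eq_square mult_ac)
  then have "X \<le> 1024 * pi * Y" using X0 Y0 by (cases "X = 0") (auto simp: mult_le_cancel_left)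
  then show "(\<integral>x. (norm (f (of_real (r x) * cis x)))\<^sup>2 \<partial>period a) \<le> 1024 * pi * (\<Sum>n. (norm (b n))\<^sup>2)"
    unfolding X_def Y_def e_def .
qed

section \<open>Measurability and square integrability of the maximal function\<close>

text \<open>Makes suprema over all radii countable and hence measurable. Rationals approach each
  point from the right, which stays inside the half-open interval even at its left end.\<close>

lemma SUP_ennreal_dense:
  fixes u :: "real \<Rightarrow> real"
  assumes "continuous_on {c..<d} u" "c < d"
  shows "(SUP r\<in>{c..<d}. ennreal (u r)) = (SUP r\<in>{c..<d} \<inter> \<rat>. ennreal (u r))"
proof (rule antisym)
  show "(SUP r\<in>{c..<d}. ennreal (u r)) \<le> (SUP r\<in>{c..<d} \<inter> \<rat>. ennreal (u r))"
  proof (rule SUP_least)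
    fix r assume r: "r \<in> {c..<d}"
    have "\<exists>q\<in>\<rat>. r < q \<and> q < min d (r + 1 / real (Suc n))" for n
      using r by (intro Rats_dense_in_real) auto
    then obtain q where q: "\<And>n. q n \<in> \<rat>" "\<And>n. r < q n" "\<And>n. q n < d" "\<And>n. q n < r + 1 / real (Suc n)"
      by (metis min_less_iff_conj)
    have "(\<lambda>n. r + 1 / real (Suc n)) \<longlonglongrightarrow> r + 0"
      by (intro tendsto_add tendsto_const LIMSEQ_Suc lim_1_over_n)
    then have "q \<longlonglongrightarrow> r"
      using q by (intro tendsto_sandwich[of "\<lambda>_. r" q _ "\<lambda>n. r + 1 / real (Suc n)"]) (auto intro!: always_eventually less_imp_le)
    then have "(\<lambda>n. u (q n)) \<longlonglongrightarrow> u r"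
      using assms r q order_trans[OF _ less_imp_le[OF q(2)]] by (intro continuous_on_tendsto_compose[OF assms(1)]) auto
    then have "(\<lambda>n. ennreal (u (q n))) \<longlonglongrightarrow> ennreal (u r)" by (intro tendsto_ennrealI)
    then show "ennreal (u r) \<le> (SUP r\<in>{c..<d} \<inter> \<rat>. ennreal (u r))"
    proof (rule LIMSEQ_le_const2)
      have "ennreal (u (q n)) \<le> (SUP r\<in>{c..<d} \<inter> \<rat>. ennreal (u r))" for n
        using q(1,3)[of n] r less_imp_le[OF q(2)[of n]] by (intro SUP_upper) auto
      then show "\<exists>N. \<forall>n\<ge>N. ennreal (u (q n)) \<le> (SUP r\<in>{c..<d} \<inter> \<rat>. ennreal (u r))" by blast
    qed
  qed
qed (auto intro!: SUP_subset_mono)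

text \<open>This is the square of the usual radial maximal function, so its plain integral is an
  \<open>L\<^sup>2\<close> norm squared; values in \<open>ennreal\<close> allow the supremum to be
  infinite.\<close>

definition radial_max :: "(complex \<Rightarrow> complex) \<Rightarrow> real \<Rightarrow> ennreal" where
  "radial_max f x = (SUP r\<in>{0..<1}. ennreal ((norm (f (of_real r * cis x)))\<^sup>2))"

lemma continuous_on_radius:
  assumes f: "f holomorphic_on ball 0 1" and "0 \<le> c"
  shows "continuous_on {c..<1} (\<lambda>r. f (of_real r * cis x))"
  by (rule continuous_on_compose2[OF holomorphic_on_imp_continuous_on[OF f]])
    (use assms(2) in \<open>auto intro!: continuous_intros simp: norm_mult\<close>)

lemma measurable_radius:
  assumes f: "f holomorphic_on ball 0 1" and "0 \<le> r" "r < 1"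
  shows "(\<lambda>x. f (of_real r * cis x)) \<in> borel_measurable borel"
  by (rule measurable_holomorphic_compose[OF f]) (use assms in \<open>auto simp: norm_mult\<close>)

lemma radial_max_rat:
  assumes f: "f holomorphic_on ball 0 1"
  shows "radial_max f x = (SUP r\<in>{0..<1} \<inter> \<rat>. ennreal ((norm (f (of_real r * cis x)))\<^sup>2))"
  unfolding radial_max_def
  by (rule SUP_ennreal_dense) (auto intro!: continuous_intros continuous_on_radius[OF f])

lemma measurable_radial_max:
  assumes f: "f holomorphic_on ball 0 1"
  shows "radial_max f \<in> borel_measurable borel"
  unfolding radial_max_rat[OF f, abs_def]
proof (rule borel_measurable_SUP)
  show "countable ({0..<1} \<inter> \<rat> :: real set)" by (intro countable_Int2 countable_rat)
  show "(\<lambda>x. ennreal ((norm (f (of_real r * cis x)))\<^sup>2)) \<in> borel_measurable borel" if "r \<in> {0..<1} \<inter> \<rat>" for r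
    using measurable_radius[OF f, of r] that by auto
qed

lemma radial_max_upper:
  assumes "0 \<le> r" "r < 1"
  shows "ennreal ((norm (f (of_real r * cis x)))\<^sup>2) \<le> radial_max f x"
  unfolding radial_max_def using assms by (intro SUP_upper) auto

text \<open>The supremum over the first \<open>m + 1\<close> rational radii is attained at a
  measurable choice of radius, to which the bound along radii applies with a constant independent of
  \<open>m\<close>. Monotone convergence then reaches all rational radii.\<close>

theorem nn_integral_radial_max_le:
  assumes f: "f holomorphic_on ball 0 1"
    and b: "\<And>z. norm z < 1 \<Longrightarrow> (\<lambda>n. b n * z ^ n) sums f z"
    and A: "summable (\<lambda>n. (norm (b n))\<^sup>2)"
  shows "(\<integral>\<^sup>+ x. radial_max f x \<partial>period a) \<le> ennreal (1024 * pi * (\<Sum>n. (norm (b n))\<^sup>2))"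
proof -
  let ?Q = "{0..<1} \<inter> \<rat> :: real set"
  have Q: "countable ?Q" "0 \<in> ?Q" by (auto intro: countable_Int2 countable_rat)
  then have "?Q \<noteq> {}" by blast
  define q where "q = from_nat_into ?Q"
  have rangeq: "range q = ?Q" unfolding q_def by (rule range_from_nat_into[OF \<open>?Q \<noteq> {}\<close> Q(1)])
  then have q: "0 \<le> q k" "q k < 1" for k by (auto dest: equalityD1)
  define u where "u k x = norm (f (of_real (q k) * cis x))" for k x
  have [measurable]: "u k \<in> borel_measurable borel" for k
    unfolding u_def using measurable_radius[OF f q] by auto
  define v where "v m x = (SUP k\<in>{..m}. ennreal ((u k x)\<^sup>2))" for m :: nat and x
  have [measurable]: "v m \<in> borel_measurable borel" for m
    unfolding v_def by measurable
  have bound: "(\<integral>\<^sup>+ x. v m x \<partial>period a) \<le> ennreal (1024 * pi * (\<Sum>n. (norm (b n))\<^sup>2))" for m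
  proof -
    \<comment> \<open>Taking the least maximizing index makes the choice of radius
      measurable.\<close>
    define k where "k x = (LEAST k. k \<le> m \<and> (\<forall>j\<in>{..m}. u j x \<le> u k x))" for x
    have [measurable]: "k \<in> measurable borel (count_space UNIV)" unfolding k_def by measurable
    have k: "k x \<le> m \<and> (\<forall>j\<in>{..m}. u j x \<le> u (k x) x)" for x
    proof -
      have "Max ((\<lambda>j. u j x) ` {..m}) \<in> (\<lambda>j. u j x) ` {..m}" by (intro Max_in) auto
      then obtain i where "i \<le> m" "Max ((\<lambda>j. u j x) ` {..m}) = u i x"
        by (metis (no_types, lifting) atMost_iff imageE)
      then have "i \<le> m \<and> (\<forall>j\<in>{..m}. u j x \<le> u i x)"
        by (metis Max_ge finite_atMost finite_imageI imageI)
      then show ?thesis unfolding k_def by (rule LeastI)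
    qed
    define r where "r x = q (k x)" for x
    have [measurable]: "r \<in> borel_measurable borel" unfolding r_def by measurable
    \<comment> \<open>Only finitely many radii compete, so they share a bound strictly below
      1.\<close>
    define R where "R = Max (q ` {..m})"
    have "R \<in> q ` {..m}" unfolding R_def by (intro Max_in) auto
    then have R: "R < 1" using q by auto
    have rR: "0 \<le> r x" "r x \<le> R" for x
      unfolding r_def R_def using q k[of x] by (auto intro!: Max_ge)
    have vr: "v m x = ennreal ((norm (f (of_real (r x) * cis x)))\<^sup>2)" for x
    proof (rule antisym)
      show "v m x \<le> ennreal ((norm (f (of_real (r x) * cis x)))\<^sup>2)"
        unfolding v_def using k[of x]
        by (intro SUP_least ennreal_leI power_mono) (auto simp: u_def r_def)
      show "ennreal ((norm (f (of_real (r x) * cis x)))\<^sup>2) \<le> v m x"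
        unfolding v_def using k[of x] by (intro SUP_upper2[of "k x"]) (auto simp: u_def r_def)
    qed
    have "(\<integral>\<^sup>+ x. v m x \<partial>period a) = ennreal (\<integral>x. (norm (f (of_real (r x) * cis x)))\<^sup>2 \<partial>period a)"
      unfolding vr by (intro nn_integral_eq_integral integral_square_along_radii_le(1)[OF f b A _ _ _ R]) (use rR in auto)
    also have "\<dots> \<le> ennreal (1024 * pi * (\<Sum>n. (norm (b n))\<^sup>2))"
      by (intro ennreal_leI integral_square_along_radii_le(2)[OF f b A _ _ _ R]) (use rR in auto)
    finally show ?thesis .
  qed
  have "radial_max f x = (SUP m. v m x)" for x
  proof -
    have "radial_max f x = (SUP k. ennreal ((u k x)\<^sup>2))"
      unfolding radial_max_rat[OF f] u_def rangeq[symmetric] image_image ..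
    also have "\<dots> = (SUP m. v m x)"
      unfolding v_def by (rule antisym; intro SUP_least) (auto intro: SUP_upper2 SUP_upper)
    finally show ?thesis .
  qed
  then have "(\<integral>\<^sup>+ x. radial_max f x \<partial>period a) = (\<integral>\<^sup>+ x. (SUP m. v m x) \<partial>period a)" by simp
  also have "\<dots> = (SUP m. \<integral>\<^sup>+ x. v m x \<partial>period a)"
    by (rule nn_integral_monotone_convergence_SUP) (auto simp: incseq_def le_fun_def v_def intro!: SUP_subset_mono)
  also have "\<dots> \<le> ennreal (1024 * pi * (\<Sum>n. (norm (b n))\<^sup>2))" by (intro SUP_least bound)
  finally show ?thesis .
qed

subsection \<open>Fatou's theorem\<close>

text \<open>Completeness gives a limit along the sequence \<open>X\<close>; the Cauchy condition
  then extends it to every approach from the left.\<close>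

lemma tendsto_at_left_Cauchy:
  fixes g :: "real \<Rightarrow> 'a::complete_space"
  assumes C: "\<And>\<epsilon>. 0 < \<epsilon> \<Longrightarrow> \<exists>c<1. \<forall>r s. c < r \<longrightarrow> r < 1 \<longrightarrow> c < s \<longrightarrow> s < 1 \<longrightarrow> dist (g r) (g s) < \<epsilon>"
  shows "\<exists>l. (g \<longlongrightarrow> l) (at_left 1)"
proof -
  define X where "X n = 1 - 1 / real (n + 2)" for n
  have X1: "X n < 1" for n unfolding X_def by simp
  have "X \<longlonglongrightarrow> 1 - 0"
    unfolding X_def by (intro tendsto_diff tendsto_const LIMSEQ_ignore_initial_segment lim_1_over_n)
  then have X: "X \<longlonglongrightarrow> 1" by simp
  have ev: "\<forall>\<^sub>F n in sequentially. c < X n" if "c < 1" for c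
    using order_tendstoD(1)[OF X that] .
  have "Cauchy (\<lambda>n. g (X n))"
  proof (rule metric_CauchyI)
    fix \<epsilon> :: real assume "0 < \<epsilon>"
    then obtain c where c: "c < 1" "\<And>r s. c < r \<Longrightarrow> r < 1 \<Longrightarrow> c < s \<Longrightarrow> s < 1 \<Longrightarrow> dist (g r) (g s) < \<epsilon>"
      using C by blast
    obtain N where "\<And>n. n \<ge> N \<Longrightarrow> c < X n" using ev[OF c(1)] by (auto simp: eventually_sequentially)
    then show "\<exists>M. \<forall>m\<ge>M. \<forall>n\<ge>M. dist (g (X m)) (g (X n)) < \<epsilon>" using c(2) X1 by blast
  qed
  then obtain l where l: "(\<lambda>n. g (X n)) \<longlonglongrightarrow> l" by (auto simp: Cauchy_convergent_iff convergent_def)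
  have "(g \<longlongrightarrow> l) (at_left 1)"
  proof (rule tendstoI)
    fix \<epsilon> :: real assume "0 < \<epsilon>"
    then obtain c where c: "c < 1" "\<And>r s. c < r \<Longrightarrow> r < 1 \<Longrightarrow> c < s \<Longrightarrow> s < 1 \<Longrightarrow> dist (g r) (g s) < \<epsilon> / 2"
      using C[of "\<epsilon> / 2"] by auto
    have "\<forall>\<^sub>F n in sequentially. c < X n \<and> dist (g (X n)) l < \<epsilon> / 2"
      using ev[OF c(1)] tendstoD[OF l, of "\<epsilon> / 2"] \<open>0 < \<epsilon>\<close> by (auto intro: eventually_conj)
    then obtain n where n: "c < X n" "dist (g (X n)) l < \<epsilon> / 2"
      by (auto simp: eventually_sequentially)
    have "\<forall>\<^sub>F r in at_left 1. c < r" using c(1) by (auto simp: eventually_at_left intro!: exI[of _ c])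
    moreover have "\<forall>\<^sub>F r in at_left (1::real). r < 1" by (simp add: eventually_at_filter)
    ultimately show "\<forall>\<^sub>F r in at_left 1. dist (g r) l < \<epsilon>"
    proof eventually_elim
      case (elim r)
      then have "dist (g r) (g (X n)) < \<epsilon> / 2" using c(2) n(1) X1 by blast
      then show ?case using n(2) dist_triangle[of "g r" l "g (X n)"] by linarith
    qed
  qed
  then show ?thesis ..
qed

lemma radial_limit_eqI:
  "((\<lambda>r. f (of_real r * \<xi>)) \<longlongrightarrow> l) (at_left 1) \<Longrightarrow> radial_limit f \<xi> = l"
  unfolding radial_limit_def by (rule tendsto_Lim) simp

lemma radii_tendsto: "filterlim (\<lambda>n. 1 - 1 / real (n + 2)) (at_left 1) sequentially"
proof -
  have "(\<lambda>n. 1 - 1 / real (n + 2)) \<longlonglongrightarrow> 1 - 0"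
    by (intro tendsto_diff tendsto_const LIMSEQ_ignore_initial_segment lim_1_over_n)
  then show ?thesis by (auto simp: filterlim_at intro!: always_eventually)
qed

lemma radii_bounds: "0 \<le> 1 - 1 / real (n + 2)" "1 - 1 / real (n + 2) < 1"
  by (auto simp: divide_le_eq)

text \<open>The Cauchy condition at 1 is written with countable quantifiers and suprema over
  rational radii, so that the set of convergence becomes measurable. \<open>Suc k\<close> avoids
  \<open>1 / real 0 = 0\<close>, which would demand that \<open>g\<close> be constant near
  1.\<close>

lemma radial_limit_exists_iff:
  fixes g :: "real \<Rightarrow> complex"
  assumes "continuous_on {0..<1} g"
  shows "(\<exists>l. (g \<longlongrightarrow> l) (at_left 1)) \<longleftrightarrow>
    (\<forall>k. \<exists>m. (SUP r\<in>{1 - 1 / real (m + 2)..<1} \<inter> \<rat>. ennreal (norm (g r - g (1 - 1 / real (m + 2))))) \<le> ennreal (1 / real (Suc k)))"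
proof -
  define \<rho> where "\<rho> m = 1 - 1 / real (m + 2)" for m
  have \<rho>: "0 \<le> \<rho> m" "\<rho> m < 1" for m unfolding \<rho>_def by (rule radii_bounds)+
  have lim\<rho>: "\<rho> \<longlonglongrightarrow> 1" using radii_tendsto by (simp add: filterlim_at \<rho>_def[abs_def])
  have rat: "(SUP r\<in>{\<rho> m..<1} \<inter> \<rat>. ennreal (norm (g r - g (\<rho> m)))) = (SUP r\<in>{\<rho> m..<1}. ennreal (norm (g r - g (\<rho> m))))" for m
    using \<rho>[of m] by (intro SUP_ennreal_dense[symmetric] continuous_intros continuous_on_subset[OF assms]) auto
  have "(SUP r\<in>{\<rho> m..<1}. ennreal (norm (g r - g (\<rho> m)))) \<le> ennreal e
     \<longleftrightarrow> (\<forall>r\<in>{\<rho> m..<1}. norm (g r - g (\<rho> m)) \<le> e)" if "0 \<le> e" for m e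
    using that by (simp add: SUP_le_iff)
  then have "(\<forall>k. \<exists>m. (SUP r\<in>{\<rho> m..<1} \<inter> \<rat>. ennreal (norm (g r - g (\<rho> m)))) \<le> ennreal (1 / real (Suc k)))
     \<longleftrightarrow> (\<forall>k. \<exists>m. \<forall>r\<in>{\<rho> m..<1}. norm (g r - g (\<rho> m)) \<le> 1 / real (Suc k))"
    unfolding rat by simp
  also have "\<dots> \<longleftrightarrow> (\<exists>l. (g \<longlongrightarrow> l) (at_left 1))"
  proof
    assume R: "\<forall>k. \<exists>m. \<forall>r\<in>{\<rho> m..<1}. norm (g r - g (\<rho> m)) \<le> 1 / real (Suc k)"
    show "\<exists>l. (g \<longlongrightarrow> l) (at_left 1)"
    proof (rule tendsto_at_left_Cauchy)
      fix \<epsilon> :: real assume "0 < \<epsilon>"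
      then obtain k where k: "1 / real (Suc k) < \<epsilon> / 2" using nat_approx_posE[of "\<epsilon> / 2"] by auto
      obtain m where m: "\<And>r. r \<in> {\<rho> m..<1} \<Longrightarrow> norm (g r - g (\<rho> m)) \<le> 1 / real (Suc k)" using R by blast
      show "\<exists>c<1. \<forall>r s. c < r \<longrightarrow> r < 1 \<longrightarrow> c < s \<longrightarrow> s < 1 \<longrightarrow> dist (g r) (g s) < \<epsilon>"
      proof (intro exI[of _ "\<rho> m"] conjI allI impI \<rho>)
        fix r s assume "\<rho> m < r" "r < 1" "\<rho> m < s" "s < 1"
        then show "dist (g r) (g s) < \<epsilon>"
          using m[of r] m[of s] k dist_triangle2[of "g r" "g s" "g (\<rho> m)"] by (simp add: dist_norm)
      qed
    qed
  next
    assume "\<exists>l. (g \<longlongrightarrow> l) (at_left 1)"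
    then obtain l where l: "(g \<longlongrightarrow> l) (at_left 1)" ..
    show "\<forall>k. \<exists>m. \<forall>r\<in>{\<rho> m..<1}. norm (g r - g (\<rho> m)) \<le> 1 / real (Suc k)"
    proof
      fix k
      have "\<forall>\<^sub>F r in at_left 1. dist (g r) l < 1 / real (Suc k) / 2" by (rule tendstoD[OF l]) simp
      then obtain c where c: "c < 1" "\<And>r. c < r \<Longrightarrow> r < 1 \<Longrightarrow> dist (g r) l < 1 / real (Suc k) / 2"
        by (auto simp: eventually_at_left[of 0])
      obtain m where m: "c < \<rho> m"
        using order_tendstoD(1)[OF lim\<rho> c(1)] by (auto simp: eventually_sequentially)
      have "norm (g r - g (\<rho> m)) \<le> 1 / real (Suc k)" if "r \<in> {\<rho> m..<1}" for r
      proof -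
        have "c < r" "r < 1" using m that by auto
        then show ?thesis
          using c(2)[of r] c(2)[OF m \<rho>(2)] dist_triangle2[of "g r" "g (\<rho> m)" l] unfolding dist_norm by linarith
      qed
      then show "\<exists>m. \<forall>r\<in>{\<rho> m..<1}. norm (g r - g (\<rho> m)) \<le> 1 / real (Suc k)" by blast
    qed
  qed
  finally show ?thesis unfolding \<rho>_def by blast
qed

lemma measurable_radial_limit:
  assumes f: "f holomorphic_on ball 0 1"
  shows "(\<lambda>x. radial_limit f (cis x)) \<in> borel_measurable borel"
proof -
  define \<rho> where "\<rho> m = 1 - 1 / real (m + 2)" for m
  have \<rho>: "0 \<le> \<rho> m" "\<rho> m < 1" for m unfolding \<rho>_def by (rule radii_bounds)+
  have fm [measurable]: "(\<lambda>x. f (of_real (\<rho> m) * cis x)) \<in> borel_measurable borel" for m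
    by (rule measurable_radius[OF f \<rho>])
  define W where "W m x = (SUP r\<in>{\<rho> m..<1} \<inter> \<rat>. ennreal (norm (f (of_real r * cis x) - f (of_real (\<rho> m) * cis x))))" for m x
  have [measurable]: "W m \<in> borel_measurable borel" for m
    unfolding W_def
  proof (rule borel_measurable_SUP)
    show "countable ({\<rho> m..<1} \<inter> \<rat>)" by (intro countable_Int2 countable_rat)
    fix r assume "r \<in> {\<rho> m..<1} \<inter> \<rat>"
    then have [measurable]: "(\<lambda>x. f (of_real r * cis x)) \<in> borel_measurable borel"
      using \<rho>[of m] by (intro measurable_radius[OF f]) auto
    show "(\<lambda>x. ennreal (norm (f (of_real r * cis x) - f (of_real (\<rho> m) * cis x)))) \<in> borel_measurable borel"
      by measurable
  qed
  define P where "P x \<longleftrightarrow> (\<forall>k. \<exists>m. W m x \<le> ennreal (1 / real (Suc k)))" for x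
  have P: "P x \<longleftrightarrow> (\<exists>l. ((\<lambda>r. f (of_real r * cis x)) \<longlongrightarrow> l) (at_left 1))" for x
    unfolding P_def W_def \<rho>_def by (rule radial_limit_exists_iff[symmetric]) (rule continuous_on_radius[OF f], simp)
  have [measurable]: "Measurable.pred borel P" unfolding P_def by measurable
  \<comment> \<open>Where no limit exists, the predicate inside \<open>Lim\<close> is identically
    false, so its default value is one constant that does not depend on \<open>x\<close>.\<close>
  have "radial_limit f (cis x) = (if P x then lim (\<lambda>m. f (of_real (\<rho> m) * cis x)) else (THE l. False))" for x
  proof (cases "P x")
    case True
    then obtain l where l: "((\<lambda>r. f (of_real r * cis x)) \<longlongrightarrow> l) (at_left 1)" unfolding P by blast
    have "(\<lambda>m. f (of_real (\<rho> m) * cis x)) \<longlonglongrightarrow> l"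
      using filterlim_compose[OF l radii_tendsto] unfolding \<rho>_def .
    then show ?thesis using True radial_limit_eqI[OF l] by (simp add: limI)
  next
    case False
    then show ?thesis unfolding P radial_limit_def t2_space_class.Lim_def by simp
  qed
  moreover have "(\<lambda>x. if P x then lim (\<lambda>m. f (of_real (\<rho> m) * cis x)) else (THE l. False)) \<in> borel_measurable borel"
    by measurable
  ultimately show ?thesis by simp
qed

text \<open>Removing a Taylor polynomial, which is continuous up to the circle, leaves a remainder
  \<open>g N\<close> whose maximal function has integral at most a constant times a tail of the
  coefficient series. Almost everywhere some remainder is therefore uniformly small along the whole
  radius, which gives the Cauchy condition.\<close>

theorem AE_radial_limit:
  assumes f: "f holomorphic_on ball 0 1"
    and b: "\<And>z. norm z < 1 \<Longrightarrow> (\<lambda>n. b n * z ^ n) sums f z"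
    and A: "summable (\<lambda>n. (norm (b n))\<^sup>2)"
  shows "AE x in period a. ((\<lambda>r. f (of_real r * cis x)) \<longlongrightarrow> radial_limit f (cis x)) (at_left 1)"
proof -
  define p where "p N z = (\<Sum>n<N. b n * z ^ n)" for N z
  define g where "g N z = f z - p N z" for N z
  define c where "c N n = (if n < N then 0 else b n)" for N n
  have g: "g N holomorphic_on ball 0 1" for N
    unfolding g_def p_def by (intro holomorphic_intros f)
  have gc: "(\<lambda>n. c N n * z ^ n) sums g N z" if "norm z < 1" for N z
  proof -
    have "(\<lambda>n. if n \<in> {..<N} then b n * z ^ n else 0) sums p N z"
      unfolding p_def by (rule sums_If_finite_set) simp
    from sums_diff[OF b[OF that] this] show ?thesis
      unfolding g_def c_def by (rule back_subst[where P = "\<lambda>h. h sums _"]) auto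
  qed
  have cs: "(\<lambda>n. (norm (c N n))\<^sup>2) sums ((\<Sum>n. (norm (b n))\<^sup>2) - (\<Sum>n<N. (norm (b n))\<^sup>2))" for N
  proof -
    have "(\<lambda>n. if n \<in> {..<N} then (norm (b n))\<^sup>2 else 0) sums (\<Sum>n<N. (norm (b n))\<^sup>2)"
      by (rule sums_If_finite_set) simp
    from sums_diff[OF summable_sums[OF A] this] show ?thesis
      unfolding c_def by (rule back_subst[where P = "\<lambda>h. h sums _"]) auto
  qed
  \<comment> \<open>The infimum over \<open>N\<close> lies below every tail bound, so its integral
    is 0 and no subsequence has to be chosen.\<close>
  define G where "G x = (INF N. radial_max (g N) x)" for x
  have [measurable]: "radial_max (g N) \<in> borel_measurable borel" for N
    by (rule measurable_radial_max[OF g])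
  have [measurable]: "G \<in> borel_measurable borel" unfolding G_def by measurable
  have le: "(\<integral>\<^sup>+ x. G x \<partial>period a) \<le> ennreal (1024 * pi * ((\<Sum>n. (norm (b n))\<^sup>2) - (\<Sum>n<N. (norm (b n))\<^sup>2)))" for N
  proof -
    have "(\<integral>\<^sup>+ x. G x \<partial>period a) \<le> (\<integral>\<^sup>+ x. radial_max (g N) x \<partial>period a)"
      unfolding G_def by (intro nn_integral_mono INF_lower) simp
    also have "\<dots> \<le> ennreal (1024 * pi * (\<Sum>n. (norm (c N n))\<^sup>2))"
      using nn_integral_radial_max_le[OF g gc] cs by (auto simp: sums_iff)
    finally show ?thesis using cs[of N] by (simp add: sums_iff)
  qed
  have "(\<lambda>N. ennreal (1024 * pi * ((\<Sum>n. (norm (b n))\<^sup>2) - (\<Sum>n<N. (norm (b n))\<^sup>2))))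
      \<longlonglongrightarrow> ennreal (1024 * pi * ((\<Sum>n. (norm (b n))\<^sup>2) - (\<Sum>n. (norm (b n))\<^sup>2)))"
    by (intro tendsto_ennrealI tendsto_intros summable_LIMSEQ[OF A])
  then have "(\<integral>\<^sup>+ x. G x \<partial>period a) \<le> ennreal (1024 * pi * ((\<Sum>n. (norm (b n))\<^sup>2) - (\<Sum>n. (norm (b n))\<^sup>2)))"
    by (rule LIMSEQ_le_const) (use le in blast)
  then have "AE x in period a. G x = 0"
    by (subst nn_integral_0_iff_AE[symmetric]) auto
  then show ?thesis
  proof eventually_elim
    case (elim x)
    have "\<exists>l. ((\<lambda>r. f (of_real r * cis x)) \<longlongrightarrow> l) (at_left 1)"
    proof (rule tendsto_at_left_Cauchy)
      \<comment> \<open>The two remainder values cost less than a third of \<open>\<epsilon>\<close>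
        each; the polynomial costs the last third, as two sixths through its value on the
        circle.\<close>
      fix \<epsilon> :: real assume \<epsilon>: "0 < \<epsilon>"
      then have "G x < ennreal ((\<epsilon> / 3)\<^sup>2)" using elim by simp
      then obtain N where N: "radial_max (g N) x < ennreal ((\<epsilon> / 3)\<^sup>2)"
        unfolding G_def by (auto simp: INF_less_iff)
      have gN: "norm (g N (of_real r * cis x)) < \<epsilon> / 3" if "0 \<le> r" "r < 1" for r
      proof -
        have "ennreal ((norm (g N (of_real r * cis x)))\<^sup>2) < ennreal ((\<epsilon> / 3)\<^sup>2)"
          using radial_max_upper[OF that] N by (rule le_less_trans)
        then have "(norm (g N (of_real r * cis x)))\<^sup>2 < (\<epsilon> / 3)\<^sup>2" by (simp add: ennreal_less_iff)
        then show ?thesis using \<epsilon> by (elim power2_less_imp_less) simp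
      qed
      have "isCont (\<lambda>r. p N (of_real r * cis x)) 1" unfolding p_def by (intro continuous_intros)
      then have P1: "((\<lambda>r. p N (of_real r * cis x)) \<longlongrightarrow> p N (of_real 1 * cis x)) (at 1)"
        unfolding isCont_def .
      have "0 < \<epsilon> / 6" using \<epsilon> by simp
      from metric_LIM_D[OF P1 this] obtain d where d: "0 < d" "\<And>r. r \<noteq> 1 \<Longrightarrow> dist r 1 < d \<Longrightarrow> dist (p N (of_real r * cis x)) (p N (of_real 1 * cis x)) < \<epsilon> / 6"
        by blast
      show "\<exists>c<1. \<forall>r s. c < r \<longrightarrow> r < 1 \<longrightarrow> c < s \<longrightarrow> s < 1 \<longrightarrow> dist (f (of_real r * cis x)) (f (of_real s * cis x)) < \<epsilon>"
      \<comment> \<open>The maximum with 0 keeps the radii nonnegative, as \<open>gN\<close>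
        requires.\<close>
      proof (intro exI[of _ "max 0 (1 - d)"] conjI allI impI)
        fix r s assume rs: "max 0 (1 - d) < r" "r < 1" "max 0 (1 - d) < s" "s < 1"
        have "dist (p N (of_real r * cis x)) (p N (of_real s * cis x)) < \<epsilon> / 3"
          using d(2)[of r] d(2)[of s] rs dist_triangle2[of "p N (of_real r * cis x)" "p N (of_real s * cis x)" "p N (of_real 1 * cis x)"]
          by (auto simp: dist_real_def)
        moreover have "f (of_real r * cis x) - f (of_real s * cis x) = (p N (of_real r * cis x) - p N (of_real s * cis x))
            + (g N (of_real r * cis x) - g N (of_real s * cis x))" by (simp add: g_def)
        moreover have "norm (g N (of_real r * cis x) - g N (of_real s * cis x)) < \<epsilon> / 3 + \<epsilon> / 3"
          using gN[of r] gN[of s] rs by (intro le_less_trans[OF norm_triangle_ineq4] add_strict_mono) auto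
        ultimately show "dist (f (of_real r * cis x)) (f (of_real s * cis x)) < \<epsilon>"
          using norm_triangle_ineq[of "p N (of_real r * cis x) - p N (of_real s * cis x)"
              "g N (of_real r * cis x) - g N (of_real s * cis x)"]
          unfolding dist_norm by simp
      qed (use d in auto)
    qed
    then show ?case using radial_limit_eqI by blast
  qed
qed

section \<open>Square integrability and Fourier coefficients of boundary functions\<close>

lemma set_lebesgue_integral_period_0:
  fixes f :: "real \<Rightarrow> 'b::{banach, second_countable_topology}"
  shows "(LBINT x:{0..2 * pi}. f x) = integral\<^sup>L (period 0) f"
  using set_lebesgue_integral_period[of 0 f] by simp

text \<open>\<open>enn2real\<close> sends infinity to 0, so the integrable function of the second
  claim is a true majorant only where the first claim holds.\<close>

lemma AE_radial_max_finite:
  assumes f: "f holomorphic_on ball 0 1"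
    and b: "\<And>z. norm z < 1 \<Longrightarrow> (\<lambda>n. b n * z ^ n) sums f z"
    and A: "summable (\<lambda>n. (norm (b n))\<^sup>2)"
  shows "AE x in period a. radial_max f x \<noteq> \<infinity>"
    and "integrable (period a) (\<lambda>x. enn2real (radial_max f x))"
proof -
  have [measurable]: "radial_max f \<in> borel_measurable borel" by (rule measurable_radial_max[OF f])
  have fin: "(\<integral>\<^sup>+ x. radial_max f x \<partial>period a) < \<infinity>"
    by (rule le_less_trans[OF nn_integral_radial_max_le[OF assms]]) simp_all
  then show AE: "AE x in period a. radial_max f x \<noteq> \<infinity>"
    by (intro nn_integral_noteq_infinite) auto
  have "(\<integral>\<^sup>+ x. ennreal (norm (enn2real (radial_max f x))) \<partial>period a) = (\<integral>\<^sup>+ x. radial_max f x \<partial>period a)"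
    using AE by (intro nn_integral_cong_AE) (auto simp: less_top)
  then show "integrable (period a) (\<lambda>x. enn2real (radial_max f x))"
    using fin by (intro integrableI_bounded) auto
qed

lemma AE_radial_limit_le:
  assumes f: "f holomorphic_on ball 0 1"
    and b: "\<And>z. norm z < 1 \<Longrightarrow> (\<lambda>n. b n * z ^ n) sums f z"
    and A: "summable (\<lambda>n. (norm (b n))\<^sup>2)"
  shows "AE x in period a. (norm (radial_limit f (cis x)))\<^sup>2 \<le> enn2real (radial_max f x)"
proof -
  have "AE x in period a. ((\<lambda>r. f (of_real r * cis x)) \<longlongrightarrow> radial_limit f (cis x)) (at_left 1)"
    using f b A by (rule AE_radial_limit)
  moreover have "AE x in period a. radial_max f x \<noteq> \<infinity>"
    using f b A by (rule AE_radial_max_finite(1))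
  ultimately show ?thesis
  proof eventually_elim
    case (elim x)
    have "(\<lambda>n. (norm (f (of_real (1 - 1 / real (n + 2)) * cis x)))\<^sup>2) \<longlonglongrightarrow> (norm (radial_limit f (cis x)))\<^sup>2"
      by (intro tendsto_intros filterlim_compose[OF elim(1) radii_tendsto])
    then show ?case
    proof (rule LIMSEQ_le_const2)
      have "(norm (f (of_real (1 - 1 / real (n + 2)) * cis x)))\<^sup>2 \<le> enn2real (radial_max f x)" for n
        using radial_max_upper[OF radii_bounds, of f n x] elim(2)
        by (metis enn2real_mono enn2real_ennreal infinity_ennreal_def top.not_eq_extremum zero_le_power2)
      then show "\<exists>N. \<forall>n\<ge>N. (norm (f (of_real (1 - 1 / real (n + 2)) * cis x)))\<^sup>2 \<le> enn2real (radial_max f x)"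
        by blast
    qed
  qed
qed

lemma integrable_radial_limit_square:
  assumes f: "f holomorphic_on ball 0 1"
    and b: "\<And>z. norm z < 1 \<Longrightarrow> (\<lambda>n. b n * z ^ n) sums f z"
    and A: "summable (\<lambda>n. (norm (b n))\<^sup>2)"
  shows "integrable (period a) (\<lambda>x. (norm (radial_limit f (cis x)))\<^sup>2)"
proof (rule Bochner_Integration.integrable_bound[OF AE_radial_max_finite(2)[OF assms]])
  show "(\<lambda>x. (norm (radial_limit f (cis x)))\<^sup>2) \<in> borel_measurable (period a)"
    using measurable_radial_limit[OF f] by (intro measurable_period) measurable
  show "AE x in period a. norm ((norm (radial_limit f (cis x)))\<^sup>2) \<le> norm (enn2real (radial_max f x))"
  proof -
    have "AE x in period a. (norm (radial_limit f (cis x)))\<^sup>2 \<le> enn2real (radial_max f x)"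
      using f b A by (rule AE_radial_limit_le)
    then show ?thesis by eventually_elim simp
  qed
qed

lemma integral_radius_coeff:
  assumes b: "\<And>z. norm z < 1 \<Longrightarrow> (\<lambda>n. b n * z ^ n) sums f z" and r: "0 \<le> r" "r < 1"
  shows "(\<integral>x. f (of_real r * cis x) * cnj (cis x ^ n) \<partial>period a) = of_real (2 * pi) * b n * of_real r ^ n"
proof -
  have "(\<lambda>m. b m * (\<integral>x. cnj (cis x ^ n) * (of_real r * cis x) ^ m \<partial>period a))
      sums (\<integral>x. f (of_real r * cis x) * cnj (cis x ^ n) \<partial>period a)"
    by (rule power_series_integral[OF b _ _ _ r(2), where B = 1]) (use r in \<open>auto simp: norm_mult norm_power\<close>)
  also have "(\<lambda>m. b m * (\<integral>x. cnj (cis x ^ n) * (of_real r * cis x) ^ m \<partial>period a))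
     = (\<lambda>m. if m = n then of_real (2 * pi) * b m * of_real r ^ m else 0)"
  proof
    fix m
    have "(\<integral>x. cnj (cis x ^ n) * (of_real r * cis x) ^ m \<partial>period a)
        = (\<integral>x. of_real r ^ m * (cnj (cis x ^ n) * cis x ^ m) \<partial>period a)"
      by (simp add: power_mult_distrib mult_ac)
    also have "\<dots> = of_real r ^ m * (if n = m then of_real (2 * pi) else 0)"
      unfolding integral_cis_orthogonal[where a = a, symmetric] by (rule integral_mult_right_zero)
    finally show "b m * (\<integral>x. cnj (cis x ^ n) * (of_real r * cis x) ^ m \<partial>period a)
       = (if m = n then of_real (2 * pi) * b m * of_real r ^ m else 0)" by auto
  qed
  finally show ?thesis using sums_single[of n "\<lambda>m. of_real (2 * pi) * b m * of_real r ^ m"] by (rule sums_unique2)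
qed

text \<open>On the circle of radius \<open>\<rho> m\<close> the integral carries the extra factor
  \<open>\<rho> m ^ n\<close>. Dominated convergence lets the radius tend to 1.\<close>

lemma integral_radial_limit_coeff:
  assumes f: "f holomorphic_on ball 0 1"
    and b: "\<And>z. norm z < 1 \<Longrightarrow> (\<lambda>n. b n * z ^ n) sums f z"
    and A: "summable (\<lambda>n. (norm (b n))\<^sup>2)"
  shows "(\<integral>x. radial_limit f (cis x) * cnj (cis x ^ n) \<partial>period a) = of_real (2 * pi) * b n"
proof -
  interpret finite_measure "period a" by (rule finite_measure_period)
  define \<rho> where "\<rho> m = 1 - 1 / real (m + 2)" for m
  have \<rho>: "0 \<le> \<rho> m" "\<rho> m < 1" for m unfolding \<rho>_def by (rule radii_bounds)+
  have lim\<rho>: "filterlim \<rho> (at_left 1) sequentially" unfolding \<rho>_def by (rule radii_tendsto)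
  have [measurable]: "(\<lambda>x. radial_limit f (cis x)) \<in> borel_measurable borel"
    by (rule measurable_radial_limit[OF f])
  have [measurable]: "(\<lambda>x. f (of_real (\<rho> m) * cis x)) \<in> borel_measurable borel" for m
    by (rule measurable_radius[OF f \<rho>])
  have lim: "AE x in period a. ((\<lambda>r. f (of_real r * cis x)) \<longlongrightarrow> radial_limit f (cis x)) (at_left 1)"
    using f b A by (rule AE_radial_limit)
  have fin: "AE x in period a. radial_max f x \<noteq> \<infinity>"
    using f b A by (rule AE_radial_max_finite(1))
  have "(\<lambda>m. \<integral>x. f (of_real (\<rho> m) * cis x) * cnj (cis x ^ n) \<partial>period a)
      \<longlonglongrightarrow> (\<integral>x. radial_limit f (cis x) * cnj (cis x ^ n) \<partial>period a)"
  \<comment> \<open>\<open>radial_max\<close> dominates the squared norm; t \<le> 1 + t^2 turns it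
    into a majorant of the norm itself.\<close>
  proof (rule integral_dominated_convergence[where w = "\<lambda>x. 1 + enn2real (radial_max f x)"])
    show "integrable (period a) (\<lambda>x. 1 + enn2real (radial_max f x))"
      using AE_radial_max_finite(2)[OF assms] by simp
    show "AE x in period a. (\<lambda>m. f (of_real (\<rho> m) * cis x) * cnj (cis x ^ n)) \<longlonglongrightarrow> radial_limit f (cis x) * cnj (cis x ^ n)"
      using lim by eventually_elim (intro tendsto_intros filterlim_compose[OF _ lim\<rho>])
    show "AE x in period a. norm (f (of_real (\<rho> m) * cis x) * cnj (cis x ^ n)) \<le> 1 + enn2real (radial_max f x)" for m
      using fin
    proof eventually_elim
      case (elim x)
      have "(norm (f (of_real (\<rho> m) * cis x)))\<^sup>2 \<le> enn2real (radial_max f x)"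
        using radial_max_upper[OF \<rho>, of f m x] elim
        by (metis enn2real_mono enn2real_ennreal infinity_ennreal_def top.not_eq_extremum zero_le_power2)
      moreover have "t \<le> 1 + t\<^sup>2" for t :: real
        using zero_le_power2[of "t - 1 / 2"] by (simp add: power2_eq_square algebra_simps)
      ultimately show ?case
        by (simp add: norm_mult norm_power) (meson add_left_mono order_trans)
    qed
  qed measurable
  moreover have "(\<integral>x. f (of_real (\<rho> m) * cis x) * cnj (cis x ^ n) \<partial>period a) = of_real (2 * pi) * b n * of_real (\<rho> m) ^ n" for m
    by (rule integral_radius_coeff[OF b \<rho>])
  moreover have "(\<lambda>m. of_real (2 * pi) * b n * of_real (\<rho> m) ^ n) \<longlonglongrightarrow> of_real (2 * pi) * b n * of_real 1 ^ n"
    using lim\<rho> by (intro tendsto_intros) (simp add: filterlim_at)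
  ultimately show ?thesis using LIMSEQ_unique by fastforce
qed

section \<open>The Hardy space in terms of Taylor coefficients\<close>

lemma hardy2_power_series:
  assumes "f \<in> hardy2" "norm z < 1"
  shows "(\<lambda>n. (deriv ^^ n) f 0 / fact n * z ^ n) sums f z"
  using holomorphic_power_series[of f 0 1 z] assms by (simp add: hardy2_def)

text \<open>Bessel on the circle of radius \<open>r\<close> bounds the first \<open>N\<close> terms,
  weighted by powers of \<open>r\<close>, by the Hardy bound \<open>B\<close>. The sum is finite, so
  \<open>r\<close> may tend to 1 before \<open>N\<close> grows.\<close>

lemma hardy2_summable:
  assumes "f \<in> hardy2"
  shows "summable (\<lambda>n. (norm ((deriv ^^ n) f 0 / fact n))\<^sup>2)"
proof -
  let ?b = "\<lambda>n. (deriv ^^ n) f 0 / fact n"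
  have f: "f holomorphic_on ball 0 1" using assms by (simp add: hardy2_def)
  note b = hardy2_power_series[OF assms]
  have "bdd_above ((\<lambda>r. (\<integral>x. (norm (f (of_real r * cis x)))\<^sup>2 \<partial>period 0) / (2 * pi)) ` {0..<1})"
    using assms by (simp add: hardy2_def set_lebesgue_integral_period_0)
  then obtain B where B: "\<And>r. 0 \<le> r \<Longrightarrow> r < 1 \<Longrightarrow> (\<integral>x. (norm (f (of_real r * cis x)))\<^sup>2 \<partial>period 0) / (2 * pi) \<le> B"
    unfolding bdd_above_def by (metis atLeastLessThan_iff imageI)
  have "(\<Sum>n<N. (norm (?b n))\<^sup>2) \<le> B" for N
  proof -
    have le: "(\<Sum>n<N. (norm (?b n) * r ^ n)\<^sup>2) \<le> B" if r: "0 \<le> r" "r < 1" for r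
    proof -
      have [measurable]: "(\<lambda>x. f (of_real r * cis x)) \<in> borel_measurable borel" by (rule measurable_radius[OF f r])
      have "compact (f ` cball 0 r)"
        using r by (intro compact_continuous_image continuous_on_subset[OF holomorphic_on_imp_continuous_on[OF f]]) auto
      then obtain D where D: "\<And>z. norm z \<le> r \<Longrightarrow> norm (f z) \<le> D"
        using compact_imp_bounded bounded_pos by (metis (no_types, lifting) bounded_iff imageI mem_cball_0)
      \<comment> \<open>\<open>bessel_period\<close> pairs with \<open>cis x ^ n\<close> without
        conjugation. Inserting the conjugate of \<open>f\<close> makes the integrals conjugates of
        the Taylor coefficients, up to the factor 2 pi \<open>r ^ n\<close>.\<close>
      have "(\<Sum>n<N. (norm (\<integral>x. cnj (f (of_real r * cis x)) * cis x ^ n \<partial>period 0))\<^sup>2)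
          \<le> 2 * pi * (\<integral>x. (norm (cnj (f (of_real r * cis x))))\<^sup>2 \<partial>period 0)"
        by (rule bessel_period[where B = D]) (use D r in \<open>auto simp: norm_mult\<close>)
      also have "\<dots> \<le> 2 * pi * (2 * pi * B)"
        using B[OF r] by (intro mult_left_mono) (auto simp: field_simps)
      finally have "(\<Sum>n<N. (norm (\<integral>x. cnj (f (of_real r * cis x)) * cis x ^ n \<partial>period 0))\<^sup>2) \<le> 2 * pi * (2 * pi * B)" .
      moreover have "norm (\<integral>x. cnj (f (of_real r * cis x)) * cis x ^ n \<partial>period 0) = 2 * pi * (norm (?b n) * r ^ n)" for n
      proof -
        have "(\<integral>x. cnj (f (of_real r * cis x)) * cis x ^ n \<partial>period 0)
            = cnj (\<integral>x. f (of_real r * cis x) * cnj (cis x ^ n) \<partial>period 0)"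
          by (subst Bochner_Integration.integral_cnj[symmetric]) simp
        also have "(\<integral>x. f (of_real r * cis x) * cnj (cis x ^ n) \<partial>period 0) = of_real (2 * pi) * ?b n * of_real r ^ n"
          by (rule integral_radius_coeff[OF b r])
        finally show ?thesis using r by (simp add: norm_mult norm_power norm_divide)
      qed
      ultimately have "(2 * pi)\<^sup>2 * (\<Sum>n<N. (norm (?b n) * r ^ n)\<^sup>2) \<le> (2 * pi)\<^sup>2 * B"
        by (simp only: power_mult_distrib[of "2 * pi"] sum_distrib_left[symmetric]) (simp add: power2_eq_square mult_ac)
      then show ?thesis by simp
    qed
    have "((\<lambda>r. \<Sum>n<N. (norm (?b n) * r ^ n)\<^sup>2) \<longlongrightarrow> (\<Sum>n<N. (norm (?b n) * 1 ^ n)\<^sup>2)) (at_left 1)"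
      by (intro tendsto_intros)
    moreover have "\<forall>\<^sub>F r in at_left (1::real). (\<Sum>n<N. (norm (?b n) * r ^ n)\<^sup>2) \<le> B"
      using le unfolding eventually_at_left[of 0 "1::real", simplified] by (intro exI[of _ 0]) auto
    ultimately have "(\<Sum>n<N. (norm (?b n) * 1 ^ n)\<^sup>2) \<le> B"
      by (intro tendsto_upperbound) auto
    then show ?thesis by simp
  qed
  then show ?thesis by (intro summableI_nonneg_bounded) auto
qed

text \<open>The bound along radii applies to the constant choice \<open>r\<close>. Its constant is
  not sharp, but it is uniform in \<open>r\<close>, which is all that membership asks.\<close>

lemma hardy2I:
  assumes b: "\<And>z. norm z < 1 \<Longrightarrow> (\<lambda>n. b n * z ^ n) sums f z"
    and A: "summable (\<lambda>n. (norm (b n))\<^sup>2)" and out: "\<And>z. z \<notin> ball 0 1 \<Longrightarrow> f z = 0"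
  shows "f \<in> hardy2"
proof -
  have f: "f holomorphic_on ball 0 1"
    by (rule power_series_holomorphic[of 0 1 b]) (use b in auto)
  have "(LBINT x:{0..2 * pi}. (norm (f (of_real r * cis x)))\<^sup>2) / (2 * pi) \<le> 1024 * pi * (\<Sum>n. (norm (b n))\<^sup>2) / (2 * pi)"
    if "r \<in> {0..<1}" for r
    using integral_square_along_radii_le(2)[OF f b A, of "\<lambda>_. r" 0 r] that
    unfolding set_lebesgue_integral_period_0 by (intro divide_right_mono) auto
  then have "bdd_above ((\<lambda>r. (LBINT x:{0..2 * pi}. (norm (f (of_real r * cis x)))\<^sup>2) / (2 * pi)) ` {0..<1})"
    by (rule bdd_aboveI2)
  then show ?thesis unfolding hardy2_def using f out by simp
qed

lemma hardy2_backward_shift: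
  assumes "f \<in> hardy2"
  shows "backward_shift f \<in> hardy2"
proof (rule hardy2I)
  show "(\<lambda>n. (deriv ^^ Suc n) f 0 / fact (Suc n) * z ^ n) sums backward_shift f z" if "norm z < 1" for z
    using backward_shift_sums[of f z] assms that by (simp add: hardy2_def)
  show "summable (\<lambda>n. (norm ((deriv ^^ Suc n) f 0 / fact (Suc n)))\<^sup>2)"
    using hardy2_summable[OF assms] summable_Suc_iff[of "\<lambda>n. (norm ((deriv ^^ n) f 0 / fact n))\<^sup>2"] by blast
  show "backward_shift f z = 0" if "z \<notin> ball 0 1" for z
    using that by (simp add: backward_shift_def)
qed

text \<open>Division by \<open>cis x\<close> on the circle is multiplication by its conjugate, so
  the boundary function of the shift is a rotation of that of \<open>f - f 0\<close>.\<close>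

lemma AE_radial_limit_backward_shift:
  assumes "f \<in> hardy2"
  shows "AE x in period a. radial_limit (backward_shift f) (cis x) = cnj (cis x) * (radial_limit f (cis x) - f 0)"
proof -
  have f: "f holomorphic_on ball 0 1" using assms by (simp add: hardy2_def)
  have "AE x in period a. ((\<lambda>r. f (of_real r * cis x)) \<longlongrightarrow> radial_limit f (cis x)) (at_left 1)"
    using f hardy2_power_series[OF assms] hardy2_summable[OF assms] by (rule AE_radial_limit)
  then show ?thesis
  proof eventually_elim
    case (elim x)
    have "((\<lambda>r. (f (of_real r * cis x) - f 0) / (of_real r * cis x)) \<longlongrightarrow> (radial_limit f (cis x) - f 0) / (of_real 1 * cis x)) (at_left 1)"
      by (intro tendsto_intros elim) auto
    \<comment> \<open>Radii in the open interval from 0 to 1 avoid the special value of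
      \<open>backward_shift\<close> at 0.\<close>
    moreover have "\<forall>\<^sub>F r in at_left (1::real). (f (of_real r * cis x) - f 0) / (of_real r * cis x) = backward_shift f (of_real r * cis x)"
      unfolding eventually_at_left[of 0 "1::real", simplified]
      by (intro exI[of _ 0]) (auto simp: backward_shift_def norm_mult)
    ultimately have "((\<lambda>r. backward_shift f (of_real r * cis x)) \<longlongrightarrow> (radial_limit f (cis x) - f 0) / (of_real 1 * cis x)) (at_left 1)"
      by (rule Lim_transform_eventually)
    then show ?case by (simp add: radial_limit_eqI divide_inverse cis_cnj mult.commute)
  qed
qed

subsection \<open>The backward shift on Campanato spaces\<close>

lemma (in finite_measure) norm_square_integrable_imp_integrable:
  fixes v :: "'a \<Rightarrow> 'b::{banach, second_countable_topology}"
  assumes [measurable]: "v \<in> borel_measurable M" and v: "integrable M (\<lambda>x. (norm (v x))\<^sup>2)"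
  shows "integrable M v"
proof -
  have "integrable M (\<lambda>x. norm (v x))"
    by (rule square_integrable_imp_integrable[OF _ v]) measurable
  then show ?thesis by (simp add: integrable_norm_iff)
qed

text \<open>Pythagoras: \<open>v - m\<close> is orthogonal to constants. General \<open>c\<close>
  shows that the mean is the best constant, and \<open>c = 0\<close> bounds the mean by the
  \<open>L\<^sup>2\<close> norm.\<close>

lemma (in finite_measure) integral_square_deviation:
  fixes v :: "'a \<Rightarrow> complex"
  assumes [measurable]: "v \<in> borel_measurable M" and v: "integrable M (\<lambda>x. (norm (v x))\<^sup>2)"
    and \<mu>: "measure M (space M) = \<mu>" "0 < \<mu>"
  defines "m \<equiv> integral\<^sup>L M v / of_real \<mu>"
  shows "(\<integral>x. (norm (v x - c))\<^sup>2 \<partial>M) = (\<integral>x. (norm (v x - m))\<^sup>2 \<partial>M) + \<mu> * (norm (m - c))\<^sup>2"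
    and "integrable M (\<lambda>x. (norm (v x - c))\<^sup>2)"
proof -
  have iv: "integrable M v"
    by (rule norm_square_integrable_imp_integrable) (use v in auto)
  have eq: "(norm (v x - c))\<^sup>2 = (norm (v x))\<^sup>2 - 2 * Re (cnj c * v x) + (norm c)\<^sup>2" for x c
    unfolding cmod_power2 by (simp add: power2_eq_square algebra_simps)
  have ic: "integrable M (\<lambda>x. Re (cnj c * v x))" for c using iv by (intro integrable_Re integrable_mult_right)
  show "integrable M (\<lambda>x. (norm (v x - c))\<^sup>2)" unfolding eq
    by (intro Bochner_Integration.integrable_add Bochner_Integration.integrable_diff integrable_mult_right v ic integrable_const)
  have int: "(\<integral>x. (norm (v x - c))\<^sup>2 \<partial>M) = (\<integral>x. (norm (v x))\<^sup>2 \<partial>M) - 2 * Re (cnj c * (of_real \<mu> * m)) + \<mu> * (norm c)\<^sup>2" for c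
  proof -
    have "(\<integral>x. Re (cnj c * v x) \<partial>M) = Re (\<integral>x. cnj c * v x \<partial>M)"
      by (intro integral_Re integrable_mult_right iv)
    also have "(\<integral>x. cnj c * v x \<partial>M) = cnj c * (of_real \<mu> * m)" using \<mu> by (simp add: m_def)
    finally have "(\<integral>x. 2 * Re (cnj c * v x) \<partial>M) = 2 * Re (cnj c * (of_real \<mu> * m))"
      by (simp only: integral_mult_right_zero)
    moreover have "integrable M (\<lambda>x. 2 * Re (cnj c * v x))" using ic by (rule integrable_mult_right)
    ultimately show ?thesis
      unfolding eq using v
      by (simp only: Bochner_Integration.integral_add Bochner_Integration.integral_diff
        Bochner_Integration.integrable_diff lebesgue_integral_const \<mu>(1) integrable_const) simp
  qed
  show "(\<integral>x. (norm (v x - c))\<^sup>2 \<partial>M) = (\<integral>x. (norm (v x - m))\<^sup>2 \<partial>M) + \<mu> * (norm (m - c))\<^sup>2"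
    unfolding int unfolding cmod_power2[of c] cmod_power2[of m] cmod_power2[of "m - c"]
    by (simp add: power2_eq_square algebra_simps)
qed

lemma dist_cis_le: "norm (cis x - cis y) \<le> \<bar>x - y\<bar>"
proof -
  have "cis x - cis y = cis y * (exp (\<i> * of_real (x - y)) - 1)"
    by (simp add: cis_conv_exp exp_add[symmetric] algebra_simps)
  then have "norm (cis x - cis y) = dist (exp (\<i> * of_real (x - y))) 1" by (simp add: norm_mult dist_norm)
  also have "\<dots> = 2 * \<bar>sin ((x - y) / 2)\<bar>" unfolding dist_norm by (rule dist_exp_i_1)
  also have "\<dots> \<le> \<bar>x - y\<bar>" using abs_sin_x_le_abs_x[of "(x - y) / 2"] by simp
  finally show ?thesis .
qed

text \<open>Compares the rotated function \<open>cnj (cis x) * u x\<close> with the constant that is the rotation of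
  the mean of \<open>u\<close> frozen at the left end of the arc.\<close>

lemma integral_rotate_deviation_le:
  fixes u :: "real \<Rightarrow> complex"
  assumes ab: "a < b"
  defines "M \<equiv> restrict_space lborel {a..b}"
  assumes [measurable]: "u \<in> borel_measurable M" and u: "integrable M (\<lambda>x. (norm (u x))\<^sup>2)"
  shows "(\<integral>x. (norm (cnj (cis x) * u x - (\<integral>x. cnj (cis x) * u x \<partial>M) / of_real (b - a)))\<^sup>2 \<partial>M)
    \<le> 2 * (\<integral>x. (norm (u x - integral\<^sup>L M u / of_real (b - a)))\<^sup>2 \<partial>M) + 2 * (b - a)\<^sup>2 * (\<integral>x. (norm (u x))\<^sup>2 \<partial>M)"
proof -
  interpret finite_measure M
    unfolding M_def by standard (use ab in \<open>simp add: emeasure_restrict_space space_restrict_space\<close>)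
  have sp: "space M = {a..b}" unfolding M_def by (simp add: space_restrict_space)
  have \<mu>: "measure M (space M) = b - a" "0 < b - a"
    using ab unfolding sp unfolding M_def by (auto simp: measure_restrict_space)
  have [measurable]: "cis \<in> borel_measurable M"
    unfolding M_def by (intro measurable_restrict_space1) simp
  define v where "v x = cnj (cis x) * u x" for x
  have [measurable]: "v \<in> borel_measurable M" unfolding v_def by measurable
  have v: "integrable M (\<lambda>x. (norm (v x))\<^sup>2)" using u by (simp add: v_def norm_mult)
  define m where "m = integral\<^sup>L M u / of_real (b - a)"
  define c where "c = cnj (cis a) * m"
  have m_le: "(b - a) * (norm m)\<^sup>2 \<le> (\<integral>x. (norm (u x))\<^sup>2 \<partial>M)"
    using integral_square_deviation(1)[OF _ u \<mu>, of 0] unfolding m_def by simp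
  \<comment> \<open>The mean minimizes the square deviation, so it may be replaced by the convenient
    constant \<open>c\<close>.\<close>
  have "(\<integral>x. (norm (v x - integral\<^sup>L M v / of_real (b - a)))\<^sup>2 \<partial>M) \<le> (\<integral>x. (norm (v x - c))\<^sup>2 \<partial>M)"
    using integral_square_deviation(1)[OF _ v \<mu>, of c] \<mu> by simp
  also have "\<dots> \<le> (\<integral>x. 2 * (norm (u x - m))\<^sup>2 + 2 * (b - a)\<^sup>2 * (norm m)\<^sup>2 \<partial>M)"
  proof (rule integral_mono)
    show "integrable M (\<lambda>x. (norm (v x - c))\<^sup>2)" by (rule integral_square_deviation(2)[OF _ v \<mu>]) simp
    show "integrable M (\<lambda>x. 2 * (norm (u x - m))\<^sup>2 + 2 * (b - a)\<^sup>2 * (norm m)\<^sup>2)"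
      using integral_square_deviation(2)[OF _ u \<mu>, of m] by simp
    fix x assume "x \<in> space M"
    then have x: "a \<le> x" "x \<le> b" by (auto simp: sp)
    have "norm (cnj (cis x) - cnj (cis a)) \<le> b - a"
      using dist_cis_le[of x a] x by (simp flip: complex_cnj_diff)
    then have "norm ((cnj (cis x) - cnj (cis a)) * m) \<le> (b - a) * norm m"
      unfolding norm_mult by (rule mult_right_mono) simp
    moreover have "v x - c = cnj (cis x) * (u x - m) + (cnj (cis x) - cnj (cis a)) * m"
      by (simp add: v_def c_def algebra_simps)
    moreover have "norm (cnj (cis x) * (u x - m)) = norm (u x - m)" by (simp add: norm_mult)
    ultimately have "norm (v x - c) \<le> norm (u x - m) + (b - a) * norm m"
      by (metis add_left_mono norm_triangle_ineq order_trans)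
    then have "(norm (v x - c))\<^sup>2 \<le> (norm (u x - m) + (b - a) * norm m)\<^sup>2"
      by (rule power_mono) simp
    also have "\<dots> \<le> 2 * (norm (u x - m))\<^sup>2 + 2 * ((b - a) * norm m)\<^sup>2"
      using zero_le_power2[of "norm (u x - m) - (b - a) * norm m"] by (simp add: power2_eq_square algebra_simps)
    finally show "(norm (v x - c))\<^sup>2 \<le> 2 * (norm (u x - m))\<^sup>2 + 2 * (b - a)\<^sup>2 * (norm m)\<^sup>2"
      by (simp add: power_mult_distrib)
  qed
  also have "\<dots> = 2 * (\<integral>x. (norm (u x - m))\<^sup>2 \<partial>M) + 2 * (b - a)\<^sup>2 * ((b - a) * (norm m)\<^sup>2)"
    using integral_square_deviation(2)[OF _ u \<mu>, of m] \<mu> by (subst Bochner_Integration.integral_add) simp_all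
  also have "\<dots> \<le> 2 * (\<integral>x. (norm (u x - m))\<^sup>2 \<partial>M) + 2 * (b - a)\<^sup>2 * (\<integral>x. (norm (u x))\<^sup>2 \<partial>M)"
    by (intro add_left_mono mult_left_mono m_le) simp
  finally show ?thesis unfolding v_def m_def .
qed

section \<open>Oscillation of the shifted function on a single arc\<close>

lemma arc_mean_eq:
  "arc_mean f (a, b) = (\<integral>x. radial_limit f (cis x) \<partial>restrict_space lborel {a..b}) / of_real (b - a)"
  unfolding arc_mean_def arc_length_def set_lebesgue_integral_def
  by (subst integral_restrict_space) simp_all

lemma arc_osc_eq:
  "arc_osc p f (a, b) = ((b - a) / (2 * pi)) powr (- p) *
     (\<integral>x. (norm (radial_limit f (cis x) - arc_mean f (a, b)))\<^sup>2 \<partial>restrict_space lborel {a..b})"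
  unfolding arc_osc_def arc_length_def set_lebesgue_integral_def
  by (subst integral_restrict_space) simp_all

lemma arc_osc_nonneg: "0 \<le> arc_osc p f I"
  by (cases I) (simp add: arc_osc_eq)

text \<open>The mean over the circle is the zeroth Fourier coefficient, which equals the zeroth
  Taylor coefficient.\<close>

lemma arc_mean_period:
  assumes "f \<in> hardy2"
  shows "arc_mean f (a, a + 2 * pi) = f 0"
proof -
  have f: "f holomorphic_on ball 0 1" using assms by (simp add: hardy2_def)
  have "(\<integral>x. radial_limit f (cis x) * cnj (cis x ^ 0) \<partial>period a) = of_real (2 * pi) * ((deriv ^^ 0) f 0 / fact 0)"
    by (rule integral_radial_limit_coeff[OF f hardy2_power_series[OF assms] hardy2_summable[OF assms]])
  then show ?thesis by (simp add: arc_mean_eq period_def)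
qed

text \<open>The full circle has normalized length 1, so the weight is 1 for every
  \<open>p\<close>.\<close>

lemma arc_osc_period:
  assumes "f \<in> hardy2"
  shows "arc_osc p f (a, a + 2 * pi) = (\<integral>x. (norm (radial_limit f (cis x) - f 0))\<^sup>2 \<partial>period a)"
  by (simp add: arc_osc_eq arc_mean_period[OF assms] period_def)

lemma integrable_radial_limit_deviation:
  assumes "f \<in> hardy2"
  shows "integrable (period a) (\<lambda>x. (norm (radial_limit f (cis x) - c))\<^sup>2)"
proof -
  interpret finite_measure "period a" by (rule finite_measure_period)
  have f: "f holomorphic_on ball 0 1" using assms by (simp add: hardy2_def)
  show ?thesis
  proof (rule integral_square_deviation(2)[of _ "2 * pi"])
    show "integrable (period a) (\<lambda>x. (norm (radial_limit f (cis x)))\<^sup>2)"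
      by (rule integrable_radial_limit_square[OF f hardy2_power_series[OF assms] hardy2_summable[OF assms]])
  qed (use measurable_period[OF measurable_radial_limit[OF f]] in auto)
qed

text \<open>The rotation estimate is applied to \<open>u = F - f 0\<close>. Subtracting
  \<open>f 0\<close> leaves the oscillation unchanged, and the squared norm of \<open>u\<close> on
  the arc is at most that on a full period, which is the oscillation there.\<close>

lemma arc_osc_backward_shift_le:
  assumes f: "f \<in> hardy2" and ab: "a < b" "b \<le> a + 2 * pi"
  shows "arc_osc p (backward_shift f) (a, b) \<le> 2 * arc_osc p f (a, b)
    + 8 * pi\<^sup>2 * arc_length (a, b) powr (2 - p) * arc_osc p f (a, a + 2 * pi)"
proof -
  define M where "M = restrict_space lborel {a..b}"
  define F where "F x = radial_limit f (cis x)" for x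
  define u where "u x = F x - f 0" for x
  have sub: "{a..b} \<subseteq> {a..a + 2 * pi}" using ab by auto
  have fin: "finite_measure M"
    unfolding M_def by standard (use ab in \<open>simp add: emeasure_restrict_space space_restrict_space\<close>)
  then interpret finite_measure M .
  have sp: "space M = {a..b}" unfolding M_def by (simp add: space_restrict_space)
  have \<mu>: "measure M (space M) = b - a" unfolding sp using ab unfolding M_def by (simp add: measure_restrict_space)
  have Fm: "F \<in> borel_measurable borel"
    unfolding F_def using f by (intro measurable_radial_limit) (simp add: hardy2_def)
  then have um: "u \<in> borel_measurable borel" unfolding u_def by measurable
  have FM: "F \<in> borel_measurable M" "u \<in> borel_measurable M"
    using Fm um unfolding M_def by (auto intro!: measurable_restrict_space1)
  have up: "integrable (period a) (\<lambda>x. (norm (u x))\<^sup>2)"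
    unfolding u_def F_def by (rule integrable_radial_limit_deviation[OF f])
  have sub_int: "set_integrable lborel {a..a + 2 * pi} h \<Longrightarrow> set_integrable lborel {a..b} h" for h :: "real \<Rightarrow> real"
    by (erule set_integrable_subset) (use sub in auto)
  have to_M: "integrable (period a) h \<Longrightarrow> integrable M h" for h :: "real \<Rightarrow> real"
    using sub_int[of h] unfolding period_def M_def set_integrable_def by (simp add: integrable_restrict_space)
  have u: "integrable M (\<lambda>x. (norm (u x))\<^sup>2)" by (rule to_M[OF up])
  have F2: "integrable M (\<lambda>x. (norm (F x))\<^sup>2)"
    using to_M[OF integrable_radial_limit_deviation[OF f, of a 0]] by (simp add: F_def)
  have iF: "integrable M F" by (rule norm_square_integrable_imp_integrable[OF FM(1) F2])
  have mean_u: "integral\<^sup>L M u / of_real (b - a) = arc_mean f (a, b) - f 0"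
  proof -
    have "integral\<^sup>L M u = integral\<^sup>L M F - of_real (b - a) * f 0"
      unfolding u_def using iF \<mu> by (simp add: scaleR_conv_of_real)
    moreover have "of_real (b - a) \<noteq> (0 :: complex)" using ab by (simp only: of_real_eq_0_iff)
    ultimately show ?thesis unfolding arc_mean_eq M_def[symmetric] F_def[symmetric]
      by (simp only: diff_divide_distrib) simp
  qed
  have "AE x in period a. radial_limit (backward_shift f) (cis x) = cnj (cis x) * u x"
    unfolding u_def F_def by (rule AE_radial_limit_backward_shift[OF f])
  then have AE: "AE x in M. radial_limit (backward_shift f) (cis x) = cnj (cis x) * u x"
    unfolding period_def M_def using sub by (subst (asm) AE_restrict_space_iff, simp, subst AE_restrict_space_iff, simp) auto
  have Gm: "(\<lambda>x. radial_limit (backward_shift f) (cis x)) \<in> borel_measurable M"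
    unfolding M_def using hardy2_backward_shift[OF f]
    by (intro measurable_restrict_space1) (simp add: measurable_radial_limit hardy2_def)
  have cm: "(\<lambda>x. cnj (cis x) * u x) \<in> borel_measurable M"
    unfolding M_def using um by (intro measurable_restrict_space1) measurable
  have mean_v: "arc_mean (backward_shift f) (a, b) = (\<integral>x. cnj (cis x) * u x \<partial>M) / of_real (b - a)"
    unfolding arc_mean_eq M_def[symmetric] using integral_cong_AE[OF Gm cm AE] by simp
  define U where "U = (\<integral>x. (norm (u x))\<^sup>2 \<partial>M)"
  have Ule: "U \<le> arc_osc p f (a, a + 2 * pi)"
  proof -
    have "(LBINT x:{a..b}. (norm (u x))\<^sup>2) \<le> (LBINT x:{a..a + 2 * pi}. (norm (u x))\<^sup>2)"
    proof -
      have "set_integrable lborel {a..a + 2 * pi} (\<lambda>x. (norm (u x))\<^sup>2)"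
        using up unfolding period_def set_integrable_def by (simp add: integrable_restrict_space)
      from this sub_int[OF this] show ?thesis
        unfolding set_lebesgue_integral_def set_integrable_def
        using sub by (intro integral_mono) (auto simp: indicator_def)
    qed
    also have "(LBINT x:{a..b}. (norm (u x))\<^sup>2) = U"
      unfolding U_def M_def set_lebesgue_integral_def by (subst integral_restrict_space) simp_all
    also have "(LBINT x:{a..a + 2 * pi}. (norm (u x))\<^sup>2) = arc_osc p f (a, a + 2 * pi)"
      unfolding set_lebesgue_integral_period arc_osc_period[OF f] u_def F_def ..
    finally show ?thesis .
  qed
  have "(\<integral>x. (norm (radial_limit (backward_shift f) (cis x) - arc_mean (backward_shift f) (a, b)))\<^sup>2 \<partial>M)
     = (\<integral>x. (norm (cnj (cis x) * u x - (\<integral>x. cnj (cis x) * u x \<partial>M) / of_real (b - a)))\<^sup>2 \<partial>M)"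
    unfolding mean_v
  proof (rule integral_cong_AE)
    show "AE x in M. (norm (radial_limit (backward_shift f) (cis x) - (\<integral>x. cnj (cis x) * u x \<partial>M) / of_real (b - a)))\<^sup>2
      = (norm (cnj (cis x) * u x - (\<integral>x. cnj (cis x) * u x \<partial>M) / of_real (b - a)))\<^sup>2"
      using AE by eventually_elim simp
  qed (use Gm cm in measurable)
  also have "\<dots> \<le> 2 * (\<integral>x. (norm (u x - integral\<^sup>L M u / of_real (b - a)))\<^sup>2 \<partial>M) + 2 * (b - a)\<^sup>2 * U"
    using integral_rotate_deviation_le[OF ab(1), of u] FM(2) u unfolding M_def U_def by blast
  also have "(\<integral>x. (norm (u x - integral\<^sup>L M u / of_real (b - a)))\<^sup>2 \<partial>M)
     = (\<integral>x. (norm (F x - arc_mean f (a, b)))\<^sup>2 \<partial>M)"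
    unfolding mean_u by (simp add: u_def)
  finally have main: "(\<integral>x. (norm (radial_limit (backward_shift f) (cis x) - arc_mean (backward_shift f) (a, b)))\<^sup>2 \<partial>M)
     \<le> 2 * (\<integral>x. (norm (F x - arc_mean f (a, b)))\<^sup>2 \<partial>M) + 2 * (b - a)\<^sup>2 * U" .
  define L where "L = (b - a) / (2 * pi)"
  have L: "0 < L" "b - a = 2 * pi * L" using ab by (auto simp: L_def)
  \<comment> \<open>With \<open>b - a = 2 * pi * L\<close> the error factor 2(b - a)^2 is 8 pi^2
    L^2; the weight \<open>L powr (- p)\<close> lowers the exponent to \<open>2 - p\<close>.\<close>
  have "L powr (- p) * (2 * (b - a)\<^sup>2 * U) = 8 * pi\<^sup>2 * (L powr (- p) * L powr 2) * U"
    using L by (simp add: power_mult_distrib)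
  also have "L powr (- p) * L powr 2 = L powr (2 - p)"
    using L by (simp add: powr_add[symmetric] del: powr_numeral)
  finally have Lp: "L powr (- p) * (2 * (b - a)\<^sup>2 * U) = 8 * pi\<^sup>2 * L powr (2 - p) * U" .
  have "arc_osc p (backward_shift f) (a, b) \<le> L powr (- p) * (2 * (\<integral>x. (norm (F x - arc_mean f (a, b)))\<^sup>2 \<partial>M) + 2 * (b - a)\<^sup>2 * U)"
    unfolding arc_osc_eq L_def[symmetric] M_def[symmetric] by (intro mult_left_mono main) simp
  also have "\<dots> = 2 * arc_osc p f (a, b) + 8 * pi\<^sup>2 * L powr (2 - p) * U"
    unfolding distrib_left Lp unfolding arc_osc_eq L_def[symmetric] M_def[symmetric] F_def[symmetric] by simp
  also have "\<dots> \<le> 2 * arc_osc p f (a, b) + 8 * pi\<^sup>2 * L powr (2 - p) * arc_osc p f (a, a + 2 * pi)"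
    using Ule by (intro add_left_mono mult_left_mono) auto
  finally show ?thesis unfolding L_def arc_length_def by simp
qed

text \<open>\<open>deriv f 0\<close> is the value of the shifted function at 0. It is the mean of
  \<open>v\<close>, the rotated \<open>f - f 0\<close>, so Pythagoras bounds it by the oscillation
  over the circle.\<close>

lemma norm_deriv_le_arc_osc:
  assumes f: "f \<in> hardy2"
  shows "(norm (deriv f 0))\<^sup>2 \<le> arc_osc p f (a, a + 2 * pi)"
proof -
  interpret finite_measure "period a" by (rule finite_measure_period)
  have holo: "f holomorphic_on ball 0 1" using f by (simp add: hardy2_def)
  note series = holo hardy2_power_series[OF f] hardy2_summable[OF f]
  define F where "F x = radial_limit f (cis x)" for x
  have [measurable]: "F \<in> borel_measurable borel"
    unfolding F_def by (rule measurable_radial_limit[OF holo])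
  define v where "v x = (F x - f 0) * cnj (cis x)" for x
  have v: "integrable (period a) (\<lambda>x. (norm (v x))\<^sup>2)"
    using integrable_radial_limit_deviation[OF f] by (simp add: v_def F_def norm_mult)
  have "integrable (period a) (\<lambda>x. (norm (F x * cnj (cis x)))\<^sup>2)"
    using integrable_radial_limit_deviation[OF f, of a 0] by (simp add: F_def norm_mult)
  then have i1: "integrable (period a) (\<lambda>x. F x * cnj (cis x))"
    by (rule norm_square_integrable_imp_integrable[rotated]) measurable
  have i2: "integrable (period a) (\<lambda>x. f 0 * cnj (cis x))"
    by (rule integrable_const_bound[of _ "norm (f 0)"]) (auto simp: norm_mult)
  have "integral\<^sup>L (period a) v = (\<integral>x. F x * cnj (cis x) \<partial>period a) - (\<integral>x. f 0 * cnj (cis x) \<partial>period a)"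
    unfolding v_def left_diff_distrib by (rule Bochner_Integration.integral_diff[OF i1 i2])
  also have "(\<integral>x. F x * cnj (cis x) \<partial>period a) = of_real (2 * pi) * deriv f 0"
    using integral_radial_limit_coeff[OF series, where n = 1 and a = a] by (simp add: F_def)
  also have "(\<integral>x. f 0 * cnj (cis x) \<partial>period a) = 0"
    using integral_cis_orthogonal[where n = 1 and m = 0 and a = a] by simp
  finally have mean: "integral\<^sup>L (period a) v / of_real (2 * pi) = deriv f 0" by simp
  have \<mu>: "measure (period a) (space (period a)) = 2 * pi" "0 < 2 * pi" by simp_all
  have "1 * (norm (deriv f 0))\<^sup>2 \<le> 2 * pi * (norm (deriv f 0))\<^sup>2"
    using pi_gt3 by (intro mult_right_mono) auto
  also have "\<dots> \<le> (\<integral>x. (norm (v x))\<^sup>2 \<partial>period a)"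
    using integral_square_deviation(1)[OF _ v \<mu>, of 0] unfolding mean by (simp add: v_def)
  also have "\<dots> = arc_osc p f (a, a + 2 * pi)"
    unfolding arc_osc_period[OF f] by (simp add: v_def F_def norm_mult)
  finally show ?thesis by simp
qed

section \<open>Boundedness in norm and vanishing oscillation\<close>

lemma full_arc: "(a, a + 2 * pi) \<in> arcs"
  by (simp add: arcs_def)

lemma arc_length_arcs: "I \<in> arcs \<Longrightarrow> 0 < arc_length I \<and> arc_length I \<le> 1"
  by (auto simp: arcs_def arc_length_def divide_le_eq)

lemma campanato_arc_osc_le:
  assumes "f \<in> campanato p" "I \<in> arcs"
  shows "arc_osc p f I \<le> (SUP I\<in>arcs. sqrt (arc_osc p f I))\<^sup>2"
proof -
  have "sqrt (arc_osc p f I) \<le> (SUP I\<in>arcs. sqrt (arc_osc p f I))"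
    using assms by (intro cSUP_upper) (auto simp: campanato_def)
  then have "(sqrt (arc_osc p f I))\<^sup>2 \<le> (SUP I\<in>arcs. sqrt (arc_osc p f I))\<^sup>2"
    by (rule power_mono) (simp add: arc_osc_nonneg)
  then show ?thesis by (simp add: arc_osc_nonneg)
qed

lemma campanato_SUP_nonneg:
  assumes "f \<in> campanato p"
  shows "0 \<le> (SUP I\<in>arcs. sqrt (arc_osc p f I))"
  by (rule order_trans[OF _ cSUP_upper[OF full_arc[of 0]]]) (use assms in \<open>auto simp: campanato_def arc_osc_nonneg\<close>)

text \<open>For \<open>p < 1\<close> the exponent \<open>2 - p\<close> exceeds 1, and lengths are at
  most 1, so the power is bounded by the length itself. This error is bounded over all arcs and
  tends to 0 with the length.\<close>

lemma arc_osc_backward_shift_le_length: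
  assumes f: "f \<in> campanato p" and I: "I \<in> arcs" and p: "p < 1"
  shows "arc_osc p (backward_shift f) I \<le> 2 * arc_osc p f I
    + 8 * pi\<^sup>2 * arc_length I * (SUP I\<in>arcs. sqrt (arc_osc p f I))\<^sup>2"
proof -
  obtain a b where ab: "I = (a, b)" "a < b" "b \<le> a + 2 * pi" using I by (auto simp: arcs_def)
  have L: "0 < arc_length I" "arc_length I \<le> 1" using arc_length_arcs[OF I] by auto
  have "arc_length I powr (2 - p) \<le> arc_length I powr 1"
    using L p by (intro powr_mono') auto
  then have Lp: "arc_length I powr (2 - p) \<le> arc_length I" using L by simp
  have "arc_osc p (backward_shift f) I \<le> 2 * arc_osc p f I
    + 8 * pi\<^sup>2 * arc_length I powr (2 - p) * arc_osc p f (a, a + 2 * pi)"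
    using arc_osc_backward_shift_le[of f a b p] f ab by (simp add: campanato_def)
  also have "\<dots> \<le> 2 * arc_osc p f I + 8 * pi\<^sup>2 * arc_length I * (SUP I\<in>arcs. sqrt (arc_osc p f I))\<^sup>2"
    using Lp L campanato_arc_osc_le[OF f full_arc[of a]]
    by (intro add_left_mono mult_mono) (auto simp: arc_osc_nonneg)
  finally show ?thesis .
qed

lemma sqrt_arc_osc_backward_shift_le:
  assumes f: "f \<in> campanato p" and I: "I \<in> arcs" and p: "p < 1"
  shows "sqrt (arc_osc p (backward_shift f) I) \<le> sqrt (2 + 8 * pi\<^sup>2) * (SUP I\<in>arcs. sqrt (arc_osc p f I))"
proof -
  let ?S = "SUP I\<in>arcs. sqrt (arc_osc p f I)"
  have "arc_osc p (backward_shift f) I \<le> 2 * ?S\<^sup>2 + 8 * pi\<^sup>2 * 1 * ?S\<^sup>2"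
    using arc_length_arcs[OF I] campanato_arc_osc_le[OF f I]
    by (intro order_trans[OF arc_osc_backward_shift_le_length[OF f I p]] add_mono mult_left_mono mult_right_mono) auto
  also have "\<dots> = (2 + 8 * pi\<^sup>2) * ?S\<^sup>2" by (simp add: algebra_simps)
  finally have "sqrt (arc_osc p (backward_shift f) I) \<le> sqrt ((2 + 8 * pi\<^sup>2) * ?S\<^sup>2)" by (rule real_sqrt_le_mono)
  then show ?thesis using campanato_SUP_nonneg[OF f] by (simp add: real_sqrt_mult)
qed

lemma backward_shift_campanato:
  assumes f: "f \<in> campanato p" and p: "p < 1"
  shows "backward_shift f \<in> campanato p"
proof -
  have "bdd_above ((\<lambda>I. sqrt (arc_osc p (backward_shift f) I)) ` arcs)"
    by (rule bdd_aboveI2) (rule sqrt_arc_osc_backward_shift_le[OF f _ p])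
  moreover have "backward_shift f \<in> hardy2" using f by (intro hardy2_backward_shift) (simp add: campanato_def)
  ultimately show ?thesis by (simp add: campanato_def)
qed

text \<open>The seminorm of \<open>f\<close> controls both parts of the norm: the value at 0 with
  constant 1, the oscillations with constant \<open>sqrt (2 + 8 * pi\<^sup>2)\<close>.\<close>

lemma campanato_norm_backward_shift_le:
  assumes f: "f \<in> campanato p" and p: "p < 1"
  shows "campanato_norm p (backward_shift f) \<le> (1 + sqrt (2 + 8 * pi\<^sup>2)) * campanato_norm p f"
proof -
  let ?S = "SUP I\<in>arcs. sqrt (arc_osc p f I)"
  have "(norm (deriv f 0))\<^sup>2 \<le> ?S\<^sup>2"
    using norm_deriv_le_arc_osc[of f p 0] campanato_arc_osc_le[OF f full_arc[of 0]] f
    by (simp add: campanato_def)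
  then have "norm (deriv f 0) \<le> ?S" using campanato_SUP_nonneg[OF f] by (rule power2_le_imp_le)
  moreover have "(SUP I\<in>arcs. sqrt (arc_osc p (backward_shift f) I)) \<le> sqrt (2 + 8 * pi\<^sup>2) * ?S"
    using full_arc by (intro cSUP_least sqrt_arc_osc_backward_shift_le[OF f _ p]) auto
  ultimately have "campanato_norm p (backward_shift f) \<le> (1 + sqrt (2 + 8 * pi\<^sup>2)) * ?S"
    unfolding campanato_norm_def by (simp add: backward_shift_def algebra_simps)
  also have "\<dots> \<le> (1 + sqrt (2 + 8 * pi\<^sup>2)) * campanato_norm p f"
    unfolding campanato_norm_def by (intro mult_left_mono) auto
  finally show ?thesis .
qed

lemma backward_shift_campanato0:
  assumes f: "f \<in> campanato0 p" and p: "p < 1"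
  shows "backward_shift f \<in> campanato0 p"
proof -
  let ?S = "SUP I\<in>arcs. sqrt (arc_osc p f I)"
  have fc: "f \<in> campanato p" using f by (simp add: campanato0_def)
  have "\<exists>\<delta>>0. \<forall>I\<in>arcs. arc_length I < \<delta> \<longrightarrow> \<bar>arc_osc p (backward_shift f) I\<bar> < \<epsilon>" if \<epsilon>: "0 < \<epsilon>" for \<epsilon>
  proof -
    \<comment> \<open>The oscillation of \<open>f\<close> enters doubled, so a quarter of
      \<open>\<epsilon>\<close> accounts for one half; the length term takes the other half.\<close>
    obtain \<delta> where \<delta>: "0 < \<delta>" "\<And>I. I \<in> arcs \<Longrightarrow> arc_length I < \<delta> \<Longrightarrow> \<bar>arc_osc p f I\<bar> < \<epsilon> / 4"
      using f \<epsilon> unfolding campanato0_def by (auto dest!: spec[of _ "\<epsilon> / 4"])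
    \<comment> \<open>Adding 1 keeps the divisor positive when the seminorm is 0.\<close>
    define D where "D = 8 * pi\<^sup>2 * ?S\<^sup>2 + 1"
    have D: "0 < D" unfolding D_def by (intro add_nonneg_pos) auto
    have "\<bar>arc_osc p (backward_shift f) I\<bar> < \<epsilon>" if I: "I \<in> arcs" "arc_length I < min \<delta> (\<epsilon> / (2 * D))" for I
    proof -
      have L: "0 < arc_length I" using arc_length_arcs[OF I(1)] by simp
      have "8 * pi\<^sup>2 * arc_length I * ?S\<^sup>2 \<le> arc_length I * D" using L by (simp add: D_def algebra_simps)
      also have "\<dots> < \<epsilon> / (2 * D) * D" using I D by (intro mult_strict_right_mono) auto
      also have "\<dots> = \<epsilon> / 2" using D by simp
      finally have "8 * pi\<^sup>2 * arc_length I * ?S\<^sup>2 < \<epsilon> / 2" .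
      then show ?thesis
        using arc_osc_backward_shift_le_length[OF fc I(1) p] \<delta>(2)[OF I(1)] I(2) arc_osc_nonneg[of p "backward_shift f" I]
        by auto
    qed
    then show ?thesis using \<delta>(1) \<epsilon> D by (intro exI[of _ "min \<delta> (\<epsilon> / (2 * D))"]) auto
  qed
  then show ?thesis using backward_shift_campanato[OF fc p] by (simp add: campanato0_def)
qed

section \<open>Linearity and conclusion\<close>

text \<open>At 0 the shift is \<open>deriv f 0\<close>, and the sum rule for \<open>deriv\<close>
  calls for differentiability there; \<open>hardy2\<close> provides it.\<close>

lemma backward_shift_add:
  assumes "f \<in> hardy2" "g \<in> hardy2"
  shows "backward_shift (\<lambda>z. f z + g z) = (\<lambda>z. backward_shift f z + backward_shift g z)"
proof -
  have "f field_differentiable at 0" "g field_differentiable at 0"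
    using assms by (auto simp: hardy2_def intro!: holomorphic_on_imp_differentiable_at[of _ "ball 0 1"])
  then show ?thesis by (auto simp: backward_shift_def fun_eq_iff add_divide_distrib[symmetric])
qed

lemma backward_shift_cmult:
  assumes "f \<in> hardy2"
  shows "backward_shift (\<lambda>z. c * f z) = (\<lambda>z. c * backward_shift f z)"
proof -
  have "f field_differentiable at 0"
    using assms by (auto simp: hardy2_def intro!: holomorphic_on_imp_differentiable_at[of _ "ball 0 1"])
  then show ?thesis by (auto simp: backward_shift_def fun_eq_iff right_diff_distrib)
qed

theorem theorem3p2:
  fixes p :: real
  assumes "p \<in> {0<..<1}"
  shows "bounded_linear_operator (campanato_norm p) (campanato p) (campanato p) backward_shift \<and>
         bounded_linear_operator (campanato_norm p) (campanato0 p) (campanato0 p) backward_shift"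
proof -
  have p: "p < 1" using assms by simp
  have V: "f \<in> campanato0 p \<Longrightarrow> f \<in> campanato p" "f \<in> campanato p \<Longrightarrow> f \<in> hardy2" for f
    by (simp_all add: campanato0_def campanato_def)
  \<comment> \<open>Linearity is inherited from \<open>hardy2\<close> through \<open>V\<close>; both
    spaces carry the same norm, so one constant serves both.\<close>
  then show ?thesis
    unfolding bounded_linear_operator_def
    using backward_shift_campanato[OF _ p] backward_shift_campanato0[OF _ p]
    by (auto intro!: backward_shift_add backward_shift_cmult campanato_norm_backward_shift_le[OF _ p]
        exI[of _ "1 + sqrt (2 + 8 * pi\<^sup>2)"])
qed

end
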